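(* Let $n\in\{0,1,2\}$, $\gamma>1$, $\gamma_*=\frac{n+3}{n+1}$, and let $S(s)=A_0s^q$ with constants $A_0>0$, $q\neq0$, $s>0$. Consider the Lagrangian $$L=\tfrac12\varphi_t^2-\frac{S(s)}{\gamma-1}\varphi^{n(1-\gamma)}\varphi_s^{1-\gamma}$$ and its Euler–Lagrange equation $(\ast)$ for $\varphi(t,s)$. Put $E=\frac{\varphi_t^2}{2}+\frac{S}{\gamma-1}\varphi^{n(1-\gamma)}\varphi_s^{1-\gamma}$ and $G=\frac{\varphi_t^2}{2}-\frac{\gamma S}{\gamma-1}\varphi^{n(1-\gamma)}\varphi_s^{1-\gamma}$. (a) If $\gamma\ne\gamma_*$, then in addition to the Noether symmetries valid for arbitrary entropy (listed in the context) there is one more, up to linear combinations: the variational symmetry $$Z_2=((n+3)\gamma+2q-n-1)\,t\partial_t+((n+1)\gamma-n-3)\,s\partial_s+(\gamma+q+1)\varphi\partial_\varphi,$$ which gives the conservation law $D_tT_2^t+D_sT_2^s=0$ on solutions of $(\ast)$ with $$T_2^t=-((n+3)\gamma+2q-n-1)\,tE-((n+1)\gamma-n-3)\,s\,\varphi_s\varphi_t+(\gamma+q+1)\varphi\varphi_t,$$ $$T_2^s=-((n+3)\gamma+2q-n-1)\,tS\varphi^{n(1-\gamma)}\varphi_t\varphi_s^{-\gamma}+((n+1)\gamma-n-3)\,s\,G+(\gamma+q+1)S\varphi^{-n\gamma+n+1}\varphi_s^{-\gamma}.$$ (b) If $\gamma=\gamma_*$ and $q\neq q_*:=-\frac{2(n+2)}{n+1}$,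 the Noether symmetries among the point symmetries of $(\ast)$ are the same as for arbitrary entropy. (c) If $\gamma=\gamma_*$ and $q=q_*$, there is one additional variational symmetry $t\partial_t+s\partial_s$, which gives the conservation law on solutions of $(\ast)$ with $$T^t=-tE-s\varphi_s\varphi_t,\qquad T^s=-tS\varphi^{n(1-\gamma)}\varphi_t\varphi_s^{-\gamma}+sG .$$
   Context: Equation $(\ast)$ is explicitly $\varphi_{tt}+\varphi^{n(1-\gamma)}\varphi_s^{-\gamma}\big(S'-n\gamma S\frac{\varphi_s}{\varphi}-\gamma S\frac{\varphi_{ss}}{\varphi_s}\big)=0$, with $\varphi_s>0$ and $\varphi>0$ when $n\ge1$; it describes one-dimensional flows of a polytropic gas in mass Lagrangian coordinates. $D_t,D_s$ are total derivatives. A point vector field $X=\xi^t\partial_t+\xi^s\partial_s+\eta^\varphi\partial_\varphi$ with coefficients depending on $(t,s,\varphi)$, prolonged to first derivatives, is a Noether symmetry of $L$ if $XL+L(D_t\xi^t+D_s\xi^s)=D_tB_1+D_sB_2$ for some functions $B_1,B_2$ of $(t,s,\varphi)$; it is variational if $B_1=B_2=0$ can be taken. The Noether symmetries valid for arbitrary entropy $S(s)$ are: $\partial_t$ for all $n,\gamma$; additionally $\partial_\varphi$ and $t\partial_\varphi$ if $n=0$; additionally $2t\partial_t+\varphi\partial_\varphi$ and $t^2\partial_t+t\varphi\partial_\varphi$ if $\gamma=\gamma_*$. *)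

theory Defs
  imports "HOL-Analysis.Analysis"
begin

section \<open>Jets and total derivatives\<close>

text \<open>Coordinates on the second-order jet space of functions \<open>\<phi>(t, s)\<close>: the fields stand for
  \<open>t\<close>, \<open>s\<close>, \<open>\<phi>\<close>, \<open>\<phi>\<^sub>t\<close>, \<open>\<phi>\<^sub>s\<close>, \<open>\<phi>\<^sub>t\<^sub>t\<close>, \<open>\<phi>\<^sub>t\<^sub>s\<close>, \<open>\<phi>\<^sub>s\<^sub>s\<close>.\<close>

record jet =
  jt :: real
  js :: real
  ju :: real
  jut :: real
  jus :: real
  jutt :: real
  juts :: real
  juss :: real

definition pd_t :: "(jet \<Rightarrow> real) \<Rightarrow> jet \<Rightarrow> real"
  where "pd_t F j = deriv (\<lambda>x. F (j\<lparr>jt := x\<rparr>)) (jt j)"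
definition pd_s :: "(jet \<Rightarrow> real) \<Rightarrow> jet \<Rightarrow> real"
  where "pd_s F j = deriv (\<lambda>x. F (j\<lparr>js := x\<rparr>)) (js j)"
definition pd_u :: "(jet \<Rightarrow> real) \<Rightarrow> jet \<Rightarrow> real"
  where "pd_u F j = deriv (\<lambda>x. F (j\<lparr>ju := x\<rparr>)) (ju j)"
definition pd_ut :: "(jet \<Rightarrow> real) \<Rightarrow> jet \<Rightarrow> real"
  where "pd_ut F j = deriv (\<lambda>x. F (j\<lparr>jut := x\<rparr>)) (jut j)"
definition pd_us :: "(jet \<Rightarrow> real) \<Rightarrow> jet \<Rightarrow> real"
  where "pd_us F j = deriv (\<lambda>x. F (j\<lparr>jus := x\<rparr>)) (jus j)"
definition pd_utt :: "(jet \<Rightarrow> real) \<Rightarrow> jet \<Rightarrow> real"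
  where "pd_utt F j = deriv (\<lambda>x. F (j\<lparr>jutt := x\<rparr>)) (jutt j)"
definition pd_uts :: "(jet \<Rightarrow> real) \<Rightarrow> jet \<Rightarrow> real"
  where "pd_uts F j = deriv (\<lambda>x. F (j\<lparr>juts := x\<rparr>)) (juts j)"
definition pd_uss :: "(jet \<Rightarrow> real) \<Rightarrow> jet \<Rightarrow> real"
  where "pd_uss F j = deriv (\<lambda>x. F (j\<lparr>juss := x\<rparr>)) (juss j)"

text \<open>The formulas below are the total derivatives of functions of \<open>(t, s, \<phi>, \<phi>\<^sub>t, \<phi>\<^sub>s)\<close>; they are
  only applied to such functions (a dependence on second derivatives would require third-order
  jet coordinates).\<close>

definition D_t :: "(jet \<Rightarrow> real) \<Rightarrow> jet \<Rightarrow> real"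
  where "D_t F j = pd_t F j + jut j * pd_u F j + jutt j * pd_ut F j + juts j * pd_us F j"
definition D_s :: "(jet \<Rightarrow> real) \<Rightarrow> jet \<Rightarrow> real"
  where "D_s F j = pd_s F j + jus j * pd_u F j + juts j * pd_ut F j + juss j * pd_us F j"

section \<open>The domain\<close>

text \<open>Positivity of \<open>\<phi>\<close> is required only for \<open>n \<ge> 1\<close>; for \<open>n = 0\<close> the value of \<open>\<phi>\<close> is
  an arbitrary real number.\<close>

definition base_dom :: "nat \<Rightarrow> (real \<times> real \<times> real) set"
  where "base_dom n = {(t, s, \<phi>). s > 0 \<and> (n \<ge> 1 \<longrightarrow> \<phi> > 0)}"

definition base :: "jet \<Rightarrow> real \<times> real \<times> real"
  where "base j = (jt j, js j, ju j)"

definition jet_dom :: "nat \<Rightarrow> jet set"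
  where "jet_dom n = {j. base j \<in> base_dom n \<and> jus j > 0}"

primrec Ck_on :: "nat \<Rightarrow> ('a::euclidean_space) set \<Rightarrow> ('a \<Rightarrow> 'b::euclidean_space) \<Rightarrow> bool" where
  "Ck_on 0 U f \<longleftrightarrow> continuous_on U f"
| "Ck_on (Suc k) U f \<longleftrightarrow>
     (\<exists>f'. (\<forall>x\<in>U. (f has_derivative f' x) (at x)) \<and> (\<forall>v. Ck_on k U (\<lambda>x. f' x v)))"

definition smooth_on :: "('a::euclidean_space) set \<Rightarrow> ('a \<Rightarrow> 'b::euclidean_space) \<Rightarrow> bool"
  where "smooth_on U f \<longleftrightarrow> (\<forall>k. Ck_on k U f)"

section \<open>Point vector fields and symmetries\<close>

text \<open>A point vector field assigns to \<open>(t, s, \<phi>)\<close> the triple \<open>(\<xi>\<^sup>t, \<xi>\<^sup>s, \<eta>\<^sup>\<phi>)\<close> of its coefficients.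
  Only its values on \<open>base_dom n\<close> matter.\<close>

type_synonym vfield = "real \<times> real \<times> real \<Rightarrow> real \<times> real \<times> real"

definition xi_t :: "vfield \<Rightarrow> jet \<Rightarrow> real"
  where "xi_t X j = fst (X (base j))"
definition xi_s :: "vfield \<Rightarrow> jet \<Rightarrow> real"
  where "xi_s X j = fst (snd (X (base j)))"
definition eta :: "vfield \<Rightarrow> jet \<Rightarrow> real"
  where "eta X j = snd (snd (X (base j)))"

definition zeta_t :: "vfield \<Rightarrow> jet \<Rightarrow> real"
  where "zeta_t X j = D_t (eta X) j - jut j * D_t (xi_t X) j - jus j * D_t (xi_s X) j"
definition zeta_s :: "vfield \<Rightarrow> jet \<Rightarrow> real"
  where "zeta_s X j = D_s (eta X) j - jut j * D_s (xi_t X) j - jus j * D_s (xi_s X) j"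
definition zeta_tt :: "vfield \<Rightarrow> jet \<Rightarrow> real"
  where "zeta_tt X j = D_t (zeta_t X) j - jutt j * D_t (xi_t X) j - juts j * D_t (xi_s X) j"
definition zeta_ts :: "vfield \<Rightarrow> jet \<Rightarrow> real"
  where "zeta_ts X j = D_s (zeta_t X) j - jutt j * D_s (xi_t X) j - juts j * D_s (xi_s X) j"
definition zeta_ss :: "vfield \<Rightarrow> jet \<Rightarrow> real"
  where "zeta_ss X j = D_s (zeta_s X) j - juts j * D_s (xi_t X) j - juss j * D_s (xi_s X) j"

definition prolong1 :: "vfield \<Rightarrow> (jet \<Rightarrow> real) \<Rightarrow> jet \<Rightarrow> real"
  where "prolong1 X F j =
    xi_t X j * pd_t F j + xi_s X j * pd_s F j + eta X j * pd_u F j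
    + zeta_t X j * pd_ut F j + zeta_s X j * pd_us F j"

definition prolong2 :: "vfield \<Rightarrow> (jet \<Rightarrow> real) \<Rightarrow> jet \<Rightarrow> real"
  where "prolong2 X F j = prolong1 X F j
    + zeta_tt X j * pd_utt F j + zeta_ts X j * pd_uts F j + zeta_ss X j * pd_uss F j"

definition noether_symmetry_with ::
    "nat \<Rightarrow> (jet \<Rightarrow> real) \<Rightarrow> vfield \<Rightarrow> (real \<times> real \<times> real \<Rightarrow> real) \<Rightarrow> (real \<times> real \<times> real \<Rightarrow> real) \<Rightarrow> bool"
  where "noether_symmetry_with n L X B1 B2 \<longleftrightarrow>
    smooth_on (base_dom n) X \<and> smooth_on (base_dom n) B1 \<and> smooth_on (base_dom n) B2 \<and>
    (\<forall>j\<in>jet_dom n.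
       prolong1 X L j + L j * (D_t (xi_t X) j + D_s (xi_s X) j)
       = D_t (\<lambda>j. B1 (base j)) j + D_s (\<lambda>j. B2 (base j)) j)"

definition noether_symmetry :: "nat \<Rightarrow> (jet \<Rightarrow> real) \<Rightarrow> vfield \<Rightarrow> bool"
  where "noether_symmetry n L X \<longleftrightarrow> (\<exists>B1 B2. noether_symmetry_with n L X B1 B2)"

definition variational_symmetry :: "nat \<Rightarrow> (jet \<Rightarrow> real) \<Rightarrow> vfield \<Rightarrow> bool"
  where "variational_symmetry n L X \<longleftrightarrow> noether_symmetry_with n L X (\<lambda>_. 0) (\<lambda>_. 0)"

text \<open>Lie's infinitesimal invariance criterion for the second-order equation \<open>F = 0\<close>.\<close>

definition point_symmetry :: "nat \<Rightarrow> (jet \<Rightarrow> real) \<Rightarrow> vfield \<Rightarrow> bool"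
  where "point_symmetry n F X \<longleftrightarrow>
    smooth_on (base_dom n) X \<and> (\<forall>j\<in>jet_dom n. F j = 0 \<longrightarrow> prolong2 X F j = 0)"

definition in_span :: "nat \<Rightarrow> vfield list \<Rightarrow> vfield \<Rightarrow> bool"
  where "in_span n Xs X \<longleftrightarrow>
    (\<exists>c. \<forall>p\<in>base_dom n. X p = (\<Sum>i<length Xs. c i *\<^sub>R (Xs ! i) p))"

text \<open>\<open>D\<^sub>t T\<^sup>t + D\<^sub>s T\<^sup>s = 0\<close> on solutions of \<open>F = 0\<close>, i.e. at all 2-jets satisfying the
  equation.\<close>

definition conservation_law ::
    "nat \<Rightarrow> (jet \<Rightarrow> real) \<Rightarrow> (jet \<Rightarrow> real) \<Rightarrow> (jet \<Rightarrow> real) \<Rightarrow> bool"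
  where "conservation_law n F Tt Ts \<longleftrightarrow>
    (\<forall>j\<in>jet_dom n. F j = 0 \<longrightarrow> D_t Tt j + D_s Ts j = 0)"

text \<open>A variational symmetry gives, by Noether's theorem, the conservation law with densities
  \<open>\<xi>\<^sup>t L + (\<eta> - \<xi>\<^sup>t \<phi>\<^sub>t - \<xi>\<^sup>s \<phi>\<^sub>s) L\<^sub>\<phi>\<^sub>t\<close> and \<open>\<xi>\<^sup>s L + (\<eta> - \<xi>\<^sup>t \<phi>\<^sub>t - \<xi>\<^sup>s \<phi>\<^sub>s) L\<^sub>\<phi>\<^sub>s\<close>.\<close>

definition characteristic :: "vfield \<Rightarrow> jet \<Rightarrow> real"
  where "characteristic X j = eta X j - xi_t X j * jut j - xi_s X j * jus j"

definition gives_conservation_law ::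
    "nat \<Rightarrow> (jet \<Rightarrow> real) \<Rightarrow> (jet \<Rightarrow> real) \<Rightarrow> vfield \<Rightarrow> (jet \<Rightarrow> real) \<Rightarrow> (jet \<Rightarrow> real) \<Rightarrow> bool"
  where "gives_conservation_law n L F X Tt Ts \<longleftrightarrow>
    conservation_law n F Tt Ts \<and>
    (\<forall>j\<in>jet_dom n. Tt j = xi_t X j * L j + characteristic X j * pd_ut L j \<and>
                   Ts j = xi_s X j * L j + characteristic X j * pd_us L j)"

section \<open>The gas dynamics equation\<close>

text \<open>\<open>\<phi>\<^bsup>n(1-\<gamma>)\<^esup>\<close>. Raising to the power \<open>n\<close> first makes this \<open>1\<close> for \<open>n = 0\<close> and
  every real \<open>\<phi>\<close>, whereas \<open>0 powr 0 = 0\<close>; for \<open>\<phi> > 0\<close> it is \<open>\<phi> powr (n * (1 - \<gamma>))\<close>.\<close>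

definition phi_pow :: "nat \<Rightarrow> real \<Rightarrow> real \<Rightarrow> real"
  where "phi_pow n \<gamma> \<phi> = (\<phi> ^ n) powr (1 - \<gamma>)"

definition gas_L :: "nat \<Rightarrow> real \<Rightarrow> (real \<Rightarrow> real) \<Rightarrow> jet \<Rightarrow> real"
  where "gas_L n \<gamma> S j =
    (jut j)\<^sup>2 / 2 - S (js j) / (\<gamma> - 1) * phi_pow n \<gamma> (ju j) * jus j powr (1 - \<gamma>)"

definition gas_eq :: "nat \<Rightarrow> real \<Rightarrow> (real \<Rightarrow> real) \<Rightarrow> jet \<Rightarrow> real"
  where "gas_eq n \<gamma> S j =
    jutt j + phi_pow n \<gamma> (ju j) * jus j powr (- \<gamma>)
      * (deriv S (js j) - real n * \<gamma> * S (js j) * jus j / ju j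
         - \<gamma> * S (js j) * juss j / jus j)"

definition gas_E :: "nat \<Rightarrow> real \<Rightarrow> (real \<Rightarrow> real) \<Rightarrow> jet \<Rightarrow> real"
  where "gas_E n \<gamma> S j =
    (jut j)\<^sup>2 / 2 + S (js j) / (\<gamma> - 1) * phi_pow n \<gamma> (ju j) * jus j powr (1 - \<gamma>)"

definition gas_G :: "nat \<Rightarrow> real \<Rightarrow> (real \<Rightarrow> real) \<Rightarrow> jet \<Rightarrow> real"
  where "gas_G n \<gamma> S j =
    (jut j)\<^sup>2 / 2 - \<gamma> * S (js j) / (\<gamma> - 1) * phi_pow n \<gamma> (ju j) * jus j powr (1 - \<gamma>)"

definition gamma_star :: "nat \<Rightarrow> real"
  where "gamma_star n = (real n + 3) / (real n + 1)"

definition q_star :: "nat \<Rightarrow> real"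
  where "q_star n = - (2 * (real n + 2) / (real n + 1))"

definition arbitrary_entropy_symmetries :: "nat \<Rightarrow> real \<Rightarrow> vfield list"
  where "arbitrary_entropy_symmetries n \<gamma> =
    [\<lambda>(t, s, \<phi>). (1, 0, 0)]
    @ (if n = 0 then [\<lambda>(t, s, \<phi>). (0, 0, 1), \<lambda>(t, s, \<phi>). (0, 0, t)] else [])
    @ (if \<gamma> = gamma_star n
       then [\<lambda>(t, s, \<phi>). (2 * t, 0, \<phi>), \<lambda>(t, s, \<phi>). (t\<^sup>2, 0, t * \<phi>)] else [])"

definition Z2 :: "nat \<Rightarrow> real \<Rightarrow> real \<Rightarrow> vfield"
  where "Z2 n \<gamma> q = (\<lambda>(t, s, \<phi>).
    (((real n + 3) * \<gamma> + 2 * q - real n - 1) * t,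
     ((real n + 1) * \<gamma> - real n - 3) * s,
     (\<gamma> + q + 1) * \<phi>))"

definition T2_t :: "nat \<Rightarrow> real \<Rightarrow> real \<Rightarrow> (real \<Rightarrow> real) \<Rightarrow> jet \<Rightarrow> real"
  where "T2_t n \<gamma> q S j =
    - ((real n + 3) * \<gamma> + 2 * q - real n - 1) * jt j * gas_E n \<gamma> S j
    - ((real n + 1) * \<gamma> - real n - 3) * js j * jus j * jut j
    + (\<gamma> + q + 1) * ju j * jut j"

text \<open>In the last summand \<open>\<phi>\<^bsup>-n\<gamma>+n+1\<^esup>\<close> is written as \<open>\<phi> \<cdot> \<phi>\<^bsup>n(1-\<gamma>)\<^esup>\<close>.\<close>

definition T2_s :: "nat \<Rightarrow> real \<Rightarrow> real \<Rightarrow> (real \<Rightarrow> real) \<Rightarrow> jet \<Rightarrow> real"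
  where "T2_s n \<gamma> q S j =
    - ((real n + 3) * \<gamma> + 2 * q - real n - 1) * jt j * S (js j) * phi_pow n \<gamma> (ju j)
        * jut j * jus j powr (- \<gamma>)
    + ((real n + 1) * \<gamma> - real n - 3) * js j * gas_G n \<gamma> S j
    + (\<gamma> + q + 1) * S (js j) * (ju j * phi_pow n \<gamma> (ju j)) * jus j powr (- \<gamma>)"

definition scaling_ts :: vfield
  where "scaling_ts = (\<lambda>(t, s, \<phi>). (t, s, 0))"

definition T_t :: "nat \<Rightarrow> real \<Rightarrow> (real \<Rightarrow> real) \<Rightarrow> jet \<Rightarrow> real"
  where "T_t n \<gamma> S j = - jt j * gas_E n \<gamma> S j - js j * jus j * jut j"

definition T_s :: "nat \<Rightarrow> real \<Rightarrow> (real \<Rightarrow> real) \<Rightarrow> jet \<Rightarrow> real"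
  where "T_s n \<gamma> S j =
    - jt j * S (js j) * phi_pow n \<gamma> (ju j) * jut j * jus j powr (- \<gamma>)
    + js j * gas_G n \<gamma> S j"

section \<open>The equation is the Euler--Lagrange equation\<close>

definition euler_lagrange :: "(jet \<Rightarrow> real) \<Rightarrow> jet \<Rightarrow> real"
  where "euler_lagrange L j = pd_u L j - D_t (pd_ut L) j - D_s (pd_us L) j"

lemma deriv_phi_pow:
  assumes "n \<ge> 1 \<longrightarrow> \<phi> > 0"
  shows "(phi_pow n \<gamma> has_real_derivative real n * (1 - \<gamma>) * phi_pow n \<gamma> \<phi> / \<phi>) (at \<phi>)"
proof (cases "n = 0")
  case True
  then show ?thesis by (simp add: phi_pow_def[abs_def])
next
  case False
  then have p: "\<phi> > 0" and n: "n \<ge> 1" using assms by auto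
  have e: "\<phi> ^ n = \<phi> * \<phi> ^ (n - 1)" using n by (cases n) auto
  have "(phi_pow n \<gamma> has_real_derivative
      (1 - \<gamma>) * (\<phi> ^ n) powr (1 - \<gamma> - 1) * (real n * \<phi> ^ (n - 1))) (at \<phi>)"
    unfolding phi_pow_def[abs_def] using p
    by (auto intro!: derivative_eq_intros DERIV_fun_powr)
  also have "(1 - \<gamma>) * (\<phi> ^ n) powr (1 - \<gamma> - 1) * (real n * \<phi> ^ (n - 1))
      = real n * (1 - \<gamma>) * phi_pow n \<gamma> \<phi> / \<phi>"
    using p by (subst powr_diff) (simp add: phi_pow_def e field_simps)
  finally show ?thesis .
qed

lemma euler_lagrange_gas_L:
  assumes "\<gamma> > 1" and j: "j \<in> jet_dom n" and S: "S differentiable (at (js j))"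
  shows "euler_lagrange (gas_L n \<gamma> S) j = - gas_eq n \<gamma> S j"
proof -
  have j': "jus j > 0" "n \<ge> 1 \<longrightarrow> ju j > 0"
    using j by (auto simp: jet_dom_def base_dom_def base_def)
  have g: "\<gamma> - 1 \<noteq> 0" using assms by simp
  note dp = deriv_phi_pow[OF j'(2), of \<gamma>]
  have dS: "(S has_real_derivative deriv S (js j)) (at (js j))"
    using S by (simp add: DERIV_deriv_iff_real_differentiable)
  have 1: "pd_u (gas_L n \<gamma> S) j
      = - S (js j) / (\<gamma> - 1) * (real n * (1 - \<gamma>) * phi_pow n \<gamma> (ju j) / ju j) * jus j powr (1 - \<gamma>)"
    unfolding pd_u_def gas_L_def
    by (rule DERIV_imp_deriv) (use g in \<open>auto intro!: derivative_eq_intros dp simp: ac_simps\<close>)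
  have 2: "pd_ut (gas_L n \<gamma> S) = jut"
    unfolding pd_ut_def gas_L_def
    by (intro ext DERIV_imp_deriv) (auto intro!: derivative_eq_intros)
  have 3: "pd_us (gas_L n \<gamma> S) k = S (js k) * phi_pow n \<gamma> (ju k) * jus k powr (- \<gamma>)"
    if "jus k > 0" for k
  proof -
    have "((\<lambda>x. x powr (1 - \<gamma>)) has_real_derivative (1 - \<gamma>) * jus k powr (- \<gamma>)) (at (jus k))"
      using has_real_derivative_powr[OF that, of "1 - \<gamma>"] by simp
    from DERIV_diff[OF DERIV_const DERIV_cmult[OF this]]
    have "((\<lambda>x. (jut k)\<^sup>2 / 2 - S (js k) / (\<gamma> - 1) * phi_pow n \<gamma> (ju k) * x powr (1 - \<gamma>))
        has_real_derivative
          0 - S (js k) / (\<gamma> - 1) * phi_pow n \<gamma> (ju k) * ((1 - \<gamma>) * jus k powr (- \<gamma>))) (at (jus k))" .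
    moreover have "0 - S (js k) / (\<gamma> - 1) * phi_pow n \<gamma> (ju k) * ((1 - \<gamma>) * jus k powr (- \<gamma>))
        = S (js k) * phi_pow n \<gamma> (ju k) * jus k powr (- \<gamma>)"
      using g by (simp add: divide_simps) (simp add: algebra_simps)
    ultimately show ?thesis
      unfolding pd_us_def gas_L_def by (simp add: DERIV_imp_deriv)
  qed
  have 4: "D_t jut j = jutt j"
    by (simp add: D_t_def pd_t_def pd_u_def pd_ut_def pd_us_def)
  have s: "pd_s (pd_us (gas_L n \<gamma> S)) j = deriv S (js j) * phi_pow n \<gamma> (ju j) * jus j powr (- \<gamma>)"
    unfolding pd_s_def using j'(1)
    by (subst 3) (auto intro!: derivative_eq_intros dS DERIV_imp_deriv)
  have u: "pd_u (pd_us (gas_L n \<gamma> S)) j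
      = S (js j) * (real n * (1 - \<gamma>) * phi_pow n \<gamma> (ju j) / ju j) * jus j powr (- \<gamma>)"
    unfolding pd_u_def using j'(1)
    by (subst 3) (auto intro!: derivative_eq_intros dp DERIV_imp_deriv)
  have ut: "pd_ut (pd_us (gas_L n \<gamma> S)) j = 0"
    unfolding pd_ut_def using j'(1) by (subst 3) auto
  have us: "pd_us (pd_us (gas_L n \<gamma> S)) j
      = S (js j) * phi_pow n \<gamma> (ju j) * (- \<gamma> * jus j powr (- \<gamma>) / jus j)"
  proof -
    have "((\<lambda>x. pd_us (gas_L n \<gamma> S) (j\<lparr>jus := x\<rparr>)) has_real_derivative
        S (js j) * phi_pow n \<gamma> (ju j) * (- \<gamma> * jus j powr (- \<gamma>) / jus j)) (at (jus j))"
    proof (rule has_field_derivative_transform_within_open[where S = "{0<..}"])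
      show "((\<lambda>x. S (js j) * phi_pow n \<gamma> (ju j) * x powr (- \<gamma>)) has_real_derivative
        S (js j) * phi_pow n \<gamma> (ju j) * (- \<gamma> * jus j powr (- \<gamma>) / jus j)) (at (jus j))"
        using DERIV_cmult[OF has_real_derivative_powr[OF j'(1), of "- \<gamma>"]] j'(1)
        by (simp add: powr_diff)
    qed (use j'(1) in \<open>auto simp: 3\<close>)
    then show ?thesis unfolding pd_us_def[of "pd_us _"] by (rule DERIV_imp_deriv)
  qed
  have pw: "jus j powr (1 - \<gamma>) = jus j * jus j powr (- \<gamma>)"
    using j'(1) by (simp add: powr_diff powr_minus field_simps)
  have 5: "pd_u (gas_L n \<gamma> S) j = real n * S (js j) * phi_pow n \<gamma> (ju j) / ju j * jus j * jus j powr (- \<gamma>)"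
  proof -
    have "S (js j) / (\<gamma> - 1) * (1 - \<gamma>) = - S (js j)" using g by (simp add: field_simps)
    have "pd_u (gas_L n \<gamma> S) j = - (S (js j) / (\<gamma> - 1) * (1 - \<gamma>))
        * (real n * phi_pow n \<gamma> (ju j) / ju j * jus j * jus j powr (- \<gamma>))"
      unfolding 1 pw by simp
    then show ?thesis
      unfolding \<open>S (js j) / (\<gamma> - 1) * (1 - \<gamma>) = - S (js j)\<close> by simp
  qed
  show ?thesis
    unfolding euler_lagrange_def gas_eq_def 5 2 4 D_s_def s u ut us
    by (simp add: algebra_simps diff_divide_distrib)
qed

end

theory Submission
  imports Defs
begin

text \<open>At a point of the base, Noether's condition is an identity in \<open>a = \<phi>\<^sub>t\<close> and \<open>b = \<phi>\<^sub>s\<close>: it is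
  cubic in \<open>a\<close>, with coefficients that are combinations of the powers of \<open>b\<close> with exponents
  \<open>-\<gamma>\<close>, \<open>1 - \<gamma>\<close>, \<open>2 - \<gamma>\<close>, \<open>0\<close>, \<open>1\<close>. The only possible coincidence \<open>2 - \<gamma> = 0\<close> is harmless, because
  the coefficient of \<open>a\<^sup>2 b\<close> already gives \<open>\<xi>\<^sup>s\<^sub>\<phi> = 0\<close>. The resulting determining equations force
  \<open>\<xi>\<^sup>s = c s\<close>, \<open>\<xi>\<^sup>t\<close> quadratic in \<open>t\<close> and \<open>\<eta> = (\<xi>\<^sup>t' - c) \<phi> / 2 + h0 + h1 t\<close>, and the equation from \<open>b\<^bsup>1-\<gamma>\<^esup>\<close>
  becomes \<open>\<beta> \<xi>\<^sup>t' = \<alpha> c\<close>, where \<open>\<alpha>\<close>, \<open>\<beta>\<close> are the coefficients of \<open>t \<partial>\<^sub>t\<close>, \<open>s \<partial>\<^sub>s\<close> in \<open>Z\<^sub>2\<close>. Since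
  \<open>\<beta> = 0\<close> iff \<open>\<gamma> = \<gamma>\<^sub>*\<close>, and then \<open>\<alpha> = 0\<close> iff \<open>q = q\<^sub>*\<close>, the three cases follow by linear algebra.\<close>

section \<open>Independence of real powers, and smooth functions\<close>

text \<open>After division by the largest power \<open>b powr m\<close> every other term tends to 0
  as \<open>b\<close> tends to infinity, which isolates \<open>c m\<close>; induction on the maximum
  disposes of the smaller exponents.\<close>

lemma powr_linearly_independent:
  fixes c :: "real \<Rightarrow> real"
  assumes "finite R" and "\<And>b. b > 0 \<Longrightarrow> (\<Sum>r\<in>R. c r * b powr r) = 0" and "r \<in> R"
  shows "c r = 0"
  using assms
proof (induction R arbitrary: r rule: finite_linorder_max_induct)
  case empty
  then show ?case by simp
next
  case (insert m A)
  have A: "m \<notin> A" using insert.hyps by auto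
  have "((\<lambda>b. c m + (\<Sum>r\<in>A. c r * b powr (r - m))) \<longlongrightarrow> c m + (\<Sum>r\<in>A. c r * 0)) at_top"
    by (intro tendsto_intros tendsto_neg_powr filterlim_ident) (use insert.hyps in auto)
  moreover have "\<forall>\<^sub>F b in at_top. c m + (\<Sum>r\<in>A. c r * b powr (r - m)) = 0"
    using eventually_gt_at_top[of 0]
  proof eventually_elim
    case (elim b)
    have "c m + (\<Sum>r\<in>A. c r * b powr (r - m)) = (\<Sum>r\<in>insert m A. c r * b powr r) / b powr m"
      using elim insert.hyps(1) A
      by (simp add: add_divide_distrib sum_divide_distrib powr_diff)
    then show ?case using insert.prems(1)[OF elim] by simp
  qed
  ultimately have m: "c m = 0"
    using tendsto_cong[of "\<lambda>b. c m + (\<Sum>r\<in>A. c r * b powr (r - m))" "\<lambda>_. 0" at_top]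
    by (auto simp: tendsto_const_iff)
  have "(\<Sum>r\<in>A. c r * b powr r) = 0" if "b > 0" for b
    using insert.prems(1)[OF that] insert.hyps(1) A m by simp
  then show ?case using insert.IH insert.prems(2) m by auto
qed

text \<open>The exponent 2 - \<gamma> is left out because it coincides with 0 when \<gamma> = 2; the
  term carrying it has to be removed before this separation is applied.\<close>

lemma four_powers_independent:
  fixes \<gamma> x y z w :: real
  assumes "\<gamma> > 1"
    and "\<And>b. b > 0 \<Longrightarrow> x * b powr (- \<gamma>) + y * b powr (1 - \<gamma>) + z + w * b = 0"
  shows "x = 0 \<and> y = 0 \<and> z = 0 \<and> w = 0"
proof -
  define c where "c = (\<lambda>r. if r = - \<gamma> then x else if r = 1 - \<gamma> then y else if r = 0 then z else w)"
  let ?R = "{- \<gamma>, 1 - \<gamma>, 0, 1}"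
  have d: "- \<gamma> \<noteq> 1 - \<gamma>" "- \<gamma> \<noteq> 0" "- \<gamma> \<noteq> 1" "1 - \<gamma> \<noteq> 0" "1 - \<gamma> \<noteq> 1" using assms(1) by auto
  have "(\<Sum>r\<in>?R. c r * b powr r) = 0" if "b > 0" for b
    using assms(2)[OF that] that d by (simp add: c_def)
  then have "c r = 0" if "r \<in> ?R" for r
    using powr_linearly_independent[of ?R c] that by blast
  from this[of "- \<gamma>"] this[of "1 - \<gamma>"] this[of 0] this[of 1] show ?thesis
    using d by (simp add: c_def)
qed

lemma cubic_vanishes:
  fixes x y z w :: real
  assumes "\<And>a. x * a ^ 3 + y * a\<^sup>2 + z * a + w = 0"
  shows "x = 0 \<and> y = 0 \<and> z = 0 \<and> w = 0"
  using assms[of 0] assms[of 1] assms[of "-1"] assms[of 2] by auto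

section \<open>Closure properties of C^k and smooth functions\<close>

lemma Ck_on_Suc_imp: "Ck_on (Suc k) U f \<Longrightarrow> Ck_on k U f"
proof (induction k arbitrary: f)
  case 0
  then show ?case
    by (auto intro!: continuous_at_imp_continuous_on dest: has_derivative_continuous)
next
  case (Suc k)
  from Suc.prems obtain f' where "\<forall>x\<in>U. (f has_derivative f' x) (at x)"
    "\<forall>v. Ck_on (Suc k) U (\<lambda>x. f' x v)" by auto
  with Suc.IH show ?case unfolding Ck_on.simps(2)[of k] by blast
qed

text \<open>Openness makes the two functions agree near each point, so they share their derivatives
  there. Vector fields are compared only on \<open>base_dom n\<close>, hence the need.\<close>

lemma Ck_on_cong:
  assumes "open U" and fg: "\<And>x. x \<in> U \<Longrightarrow> f x = g x" and "Ck_on k U f"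
  shows "Ck_on k U g"
proof (cases k)
  case 0
  then show ?thesis using assms continuous_on_cong[of U U f g] by auto
next
  case (Suc m)
  then show ?thesis
    using assms by simp (blast intro: has_derivative_transform_within_open[where s = U])
qed

lemma Ck_on_const: "Ck_on k U (\<lambda>_. c)"
  by (induction k arbitrary: c) (auto intro!: exI[of _ "\<lambda>_ _. 0"])

lemma Ck_on_bounded_linear: "bounded_linear f \<Longrightarrow> Ck_on k U f"
  by (cases k)
    (auto intro!: exI[of _ "\<lambda>_. f"] Ck_on_const bounded_linear_imp_has_derivative
      linear_continuous_on)

lemma Ck_on_add: "Ck_on k U f \<Longrightarrow> Ck_on k U g \<Longrightarrow> Ck_on k U (\<lambda>x. f x + g x)"
proof (induction k arbitrary: f g)
  case 0
  then show ?case by (simp add: continuous_on_add continuous_on_mult continuous_on_Pair)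
next
  case (Suc k)
  from Suc.prems obtain f' g' where
    "\<forall>x\<in>U. (f has_derivative f' x) (at x)" "\<forall>v. Ck_on k U (\<lambda>x. f' x v)"
    "\<forall>x\<in>U. (g has_derivative g' x) (at x)" "\<forall>v. Ck_on k U (\<lambda>x. g' x v)" by auto
  with Suc.IH show ?case
    by (auto intro!: exI[of _ "\<lambda>x v. f' x v + g' x v"] has_derivative_add)
qed

lemma Ck_on_Pair: "Ck_on k U f \<Longrightarrow> Ck_on k U g \<Longrightarrow> Ck_on k U (\<lambda>x. (f x, g x))"
proof (induction k arbitrary: f g)
  case 0
  then show ?case by (simp add: continuous_on_add continuous_on_mult continuous_on_Pair)
next
  case (Suc k)
  from Suc.prems obtain f' g' where
    "\<forall>x\<in>U. (f has_derivative f' x) (at x)" "\<forall>v. Ck_on k U (\<lambda>x. f' x v)"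
    "\<forall>x\<in>U. (g has_derivative g' x) (at x)" "\<forall>v. Ck_on k U (\<lambda>x. g' x v)" by auto
  with Suc.IH show ?case
    by (auto intro!: exI[of _ "\<lambda>x v. (f' x v, g' x v)"] has_derivative_Pair)
qed

lemma Ck_on_mult:
  fixes f g :: "'a::euclidean_space \<Rightarrow> real"
  shows "Ck_on k U f \<Longrightarrow> Ck_on k U g \<Longrightarrow> Ck_on k U (\<lambda>x. f x * g x)"
proof (induction k arbitrary: f g)
  case 0
  then show ?case by (simp add: continuous_on_add continuous_on_mult continuous_on_Pair)
next
  case (Suc k)
  from Suc.prems obtain f' g' where
    d: "\<forall>x\<in>U. (f has_derivative f' x) (at x)" "\<forall>v. Ck_on k U (\<lambda>x. f' x v)"
    "\<forall>x\<in>U. (g has_derivative g' x) (at x)" "\<forall>v. Ck_on k U (\<lambda>x. g' x v)" by auto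
  \<comment> \<open>The product rule keeps one factor undifferentiated, so that factor has to be
    lowered from C^(k+1) to C^k.\<close>
  have "Ck_on k U (\<lambda>x. f x * g' x v + f' x v * g x)" for v
    by (intro Ck_on_add Suc.IH d(2,4)[rule_format] Ck_on_Suc_imp[OF Suc.prems(1)]
        Ck_on_Suc_imp[OF Suc.prems(2)])
  with d(1,3) show ?case
    by (auto intro!: exI[of _ "\<lambda>x v. f x * g' x v + f' x v * g x"] has_derivative_mult)
qed

lemma smooth_on_const: "smooth_on U (\<lambda>_. c)"
  and smooth_on_bounded_linear: "bounded_linear f \<Longrightarrow> smooth_on U f"
  and smooth_on_add: "smooth_on U f \<Longrightarrow> smooth_on U g \<Longrightarrow> smooth_on U (\<lambda>x. f x + g x)"
  and smooth_on_Pair: "smooth_on U f \<Longrightarrow> smooth_on U h \<Longrightarrow> smooth_on U (\<lambda>x. (f x, h x))"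
  by (simp_all add: smooth_on_def Ck_on_const Ck_on_bounded_linear Ck_on_add Ck_on_Pair)

lemma smooth_on_mult:
  fixes f g :: "'a::euclidean_space \<Rightarrow> real"
  shows "smooth_on U f \<Longrightarrow> smooth_on U g \<Longrightarrow> smooth_on U (\<lambda>x. f x * g x)"
  by (simp add: smooth_on_def Ck_on_mult)

lemma smooth_on_cong:
  "open U \<Longrightarrow> (\<And>x. x \<in> U \<Longrightarrow> f x = g x) \<Longrightarrow> smooth_on U f \<Longrightarrow> smooth_on U g"
  unfolding smooth_on_def by (metis Ck_on_cong)

lemma smooth_on_imp_differentiable: "smooth_on U f \<Longrightarrow> x \<in> U \<Longrightarrow> f differentiable (at x)"
  unfolding smooth_on_def differentiable_def using Ck_on.simps(2)[of 0 U f] by blast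

section \<open>Point functions on the jet space\<close>

fun part_t :: "(real \<times> real \<times> real \<Rightarrow> real) \<Rightarrow> real \<times> real \<times> real \<Rightarrow> real"
  where "part_t f (t, s, u) = deriv (\<lambda>x. f (x, s, u)) t"
fun part_s :: "(real \<times> real \<times> real \<Rightarrow> real) \<Rightarrow> real \<times> real \<times> real \<Rightarrow> real"
  where "part_s f (t, s, u) = deriv (\<lambda>x. f (t, x, u)) s"
fun part_u :: "(real \<times> real \<times> real \<Rightarrow> real) \<Rightarrow> real \<times> real \<times> real \<Rightarrow> real"
  where "part_u f (t, s, u) = deriv (\<lambda>x. f (t, s, x)) u"

lemma D_t_base: "D_t (\<lambda>j. f (base j)) j = part_t f (base j) + jut j * part_u f (base j)"
  and D_s_base: "D_s (\<lambda>j. f (base j)) j = part_s f (base j) + jus j * part_u f (base j)"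
  by (simp_all add: D_t_def D_s_def pd_t_def pd_s_def pd_u_def pd_ut_def pd_us_def base_def)

text \<open>\<open>deriv\<close> is total, so a value of \<open>part_t\<close>,
  \<open>part_s\<close> or \<open>part_u\<close> says something only where a derivative exists.
  Differentiability at the point restricts to each coordinate line.\<close>

lemma part_DERIV:
  assumes "f differentiable (at (t, s, u))"
  shows "((\<lambda>x. f (x, s, u)) has_real_derivative part_t f (t, s, u)) (at t)"
    and "((\<lambda>x. f (t, x, u)) has_real_derivative part_s f (t, s, u)) (at s)"
    and "((\<lambda>x. f (t, s, x)) has_real_derivative part_u f (t, s, u)) (at u)"
proof -
  have "(\<lambda>x. f (x, s, u)) differentiable (at t)" "(\<lambda>x. f (t, x, u)) differentiable (at s)"
    "(\<lambda>x. f (t, s, x)) differentiable (at u)"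
    by (rule differentiable_compose[of f]; use assms in \<open>auto intro!: differentiableI
        has_derivative_Pair has_derivative_const has_derivative_ident\<close>)+
  then show "((\<lambda>x. f (x, s, u)) has_real_derivative part_t f (t, s, u)) (at t)"
    "((\<lambda>x. f (t, x, u)) has_real_derivative part_s f (t, s, u)) (at s)"
    "((\<lambda>x. f (t, s, x)) has_real_derivative part_u f (t, s, u)) (at u)"
    by (simp_all add: DERIV_deriv_iff_real_differentiable)
qed

lemma open_base_dom: "open (base_dom n)"
proof -
  have "base_dom n = {p. fst (snd p) > 0} \<inter> (if n \<ge> 1 then {p. snd (snd p) > 0} else UNIV)"
    by (auto simp: base_dom_def)
  then show ?thesis
    by (auto intro!: open_Int open_Collect_less continuous_intros)
qed

text \<open>Each coordinate line stays in the domain near one of its points, so functions agreeing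
  only on the domain still have equal partial derivatives there.\<close>

lemma eventually_base_dom:
  assumes "(t, s, u) \<in> base_dom n"
  shows "\<forall>\<^sub>F x in nhds t. (x, s, u) \<in> base_dom n"
    and "\<forall>\<^sub>F x in nhds s. (t, x, u) \<in> base_dom n"
    and "\<forall>\<^sub>F x in nhds u. (t, s, x) \<in> base_dom n"
  using assms eventually_nhds_in_open[of "{0<..}" s] eventually_nhds_in_open[of "{0<..}" u]
  by (auto simp: base_dom_def elim: eventually_mono)

lemma part_cong:
  assumes "\<And>p. p \<in> base_dom n \<Longrightarrow> f p = g p" and "p \<in> base_dom n"
  shows "part_t f p = part_t g p" "part_s f p = part_s g p" "part_u f p = part_u g p"
proof -
  obtain t s u where p: "p = (t, s, u)" by (cases p)
  show "part_t f p = part_t g p" "part_s f p = part_s g p" "part_u f p = part_u g p"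
    unfolding p part_t.simps part_s.simps part_u.simps
    by (rule deriv_cong_ev, rule eventually_mono[OF eventually_base_dom(1)[OF assms(2)[unfolded p]]],
        auto simp: assms(1))
      (rule deriv_cong_ev, rule eventually_mono[OF eventually_base_dom(2)[OF assms(2)[unfolded p]]],
        auto simp: assms(1),
       rule deriv_cong_ev, rule eventually_mono[OF eventually_base_dom(3)[OF assms(2)[unfolded p]]],
        auto simp: assms(1))
qed

section \<open>The Lagrangian for power-law entropy\<close>

locale power_entropy_gas =
  fixes n :: nat and \<gamma> A q :: real and S :: "real \<Rightarrow> real"
  assumes gamma: "\<gamma> > 1" and A: "A > 0" and S_def: "S = (\<lambda>s. A * s powr q)"
begin

text \<open>The part of the internal energy that depends on the base point. Its logarithmic
  derivatives are \<open>q / s\<close> and \<open>n * (1 - \<gamma>) / u\<close>, so every identity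
  below stays linear in \<open>W\<close>.\<close>

definition W :: "real \<Rightarrow> real \<Rightarrow> real"
  where "W s u = S s / (\<gamma> - 1) * phi_pow n \<gamma> u"

lemma S_DERIV: "s > 0 \<Longrightarrow> (S has_real_derivative q * S s / s) (at s)"
  unfolding S_def by (auto intro!: derivative_eq_intros simp: powr_diff)

text \<open>Positivity allows \<open>W\<close> to be cancelled from the coefficients of the Noether
  identity.\<close>

lemma W_pos: "(t, s, u) \<in> base_dom n \<Longrightarrow> W s u > 0"
  unfolding W_def using gamma A by (cases "n = 0") (auto simp: S_def phi_pow_def base_dom_def)

lemma W_DERIV_s: "s > 0 \<Longrightarrow> ((\<lambda>s. W s u) has_real_derivative q / s * W s u) (at s)"
  unfolding W_def using gamma by (auto intro!: derivative_eq_intros S_DERIV)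

lemma W_DERIV_u:
  "n \<ge> 1 \<longrightarrow> u > 0 \<Longrightarrow> ((\<lambda>u. W s u) has_real_derivative real n * (1 - \<gamma>) / u * W s u) (at u)"
  unfolding W_def using gamma by (auto intro!: derivative_eq_intros deriv_phi_pow)

lemma gas_L_W: "gas_L n \<gamma> S j = (jut j)\<^sup>2 / 2 - W (js j) (ju j) * jus j powr (1 - \<gamma>)"
  by (simp add: gas_L_def W_def)

lemma pd_gas_L:
  assumes "j \<in> jet_dom n"
  shows "pd_t (gas_L n \<gamma> S) j = 0"
    and "pd_s (gas_L n \<gamma> S) j = - (q / js j * W (js j) (ju j) * jus j powr (1 - \<gamma>))"
    and "pd_u (gas_L n \<gamma> S) j = - (real n * (1 - \<gamma>) / ju j * W (js j) (ju j) * jus j powr (1 - \<gamma>))"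
    and "pd_ut (gas_L n \<gamma> S) j = jut j"
    and "pd_us (gas_L n \<gamma> S) j = (\<gamma> - 1) * W (js j) (ju j) * jus j powr (- \<gamma>)"
proof -
  have j: "js j > 0" "n \<ge> 1 \<longrightarrow> ju j > 0" "jus j > 0"
    using assms by (auto simp: jet_dom_def base_dom_def base_def)
  have "((\<lambda>x. x powr (1 - \<gamma>)) has_real_derivative (1 - \<gamma>) * jus j powr (- \<gamma>)) (at (jus j))"
    using has_real_derivative_powr[OF j(3), of "1 - \<gamma>"] by simp
  note d = this W_DERIV_s[OF j(1)] W_DERIV_u[OF j(2)]
  show "pd_t (gas_L n \<gamma> S) j = 0"
    "pd_s (gas_L n \<gamma> S) j = - (q / js j * W (js j) (ju j) * jus j powr (1 - \<gamma>))"
    "pd_u (gas_L n \<gamma> S) j = - (real n * (1 - \<gamma>) / ju j * W (js j) (ju j) * jus j powr (1 - \<gamma>))"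
    "pd_ut (gas_L n \<gamma> S) j = jut j"
    unfolding pd_t_def pd_s_def pd_u_def pd_ut_def gas_L_W
    by (auto intro!: DERIV_imp_deriv derivative_eq_intros d simp: algebra_simps)
  show "pd_us (gas_L n \<gamma> S) j = (\<gamma> - 1) * W (js j) (ju j) * jus j powr (- \<gamma>)"
    using DERIV_imp_deriv[OF DERIV_diff[OF DERIV_const DERIV_cmult[OF d(1)]],
        of "(jut j)\<^sup>2 / 2" "W (js j) (ju j)"]
    by (simp add: pd_us_def gas_L_W) (simp add: algebra_simps)
qed

text \<open>Sorts the difference of the two sides by powers of \<open>a\<close> and
  \<open>b\<close>. Over a fixed base point all partial derivatives are constants, so the vanishing
  of this expression can be tested coefficient by coefficient.\<close>

lemma noether_residual:
  fixes X :: vfield and B1 B2 :: "real \<times> real \<times> real \<Rightarrow> real"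
  defines "\<tau> \<equiv> \<lambda>p. fst (X p)" and "\<sigma> \<equiv> \<lambda>p. fst (snd (X p))" and "\<eta> \<equiv> \<lambda>p. snd (snd (X p))"
  assumes "j \<in> jet_dom n"
  defines "p \<equiv> base j" and "a \<equiv> jut j" and "b \<equiv> jus j" and "w \<equiv> W (js j) (ju j)"
  shows "prolong1 X (gas_L n \<gamma> S) j + gas_L n \<gamma> S j * (D_t (xi_t X) j + D_s (xi_s X) j)
      - (D_t (\<lambda>j. B1 (base j)) j + D_s (\<lambda>j. B2 (base j)) j) =
    - part_u \<tau> p / 2 * a ^ 3
    + (part_u \<eta> p - part_t \<tau> p / 2 + part_s \<sigma> p / 2 - part_u \<sigma> p / 2 * b) * a\<^sup>2
    + (part_t \<eta> p - part_u B1 p - part_t \<sigma> p * b - (\<gamma> - 1) * w * part_s \<tau> p * b powr (- \<gamma>)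
        - \<gamma> * w * part_u \<tau> p * b powr (1 - \<gamma>)) * a
    + ((\<gamma> - 1) * w * part_s \<eta> p * b powr (- \<gamma>)
      + w * (- (\<sigma> p * (q / js j) + \<eta> p * (real n * (1 - \<gamma>) / ju j))
          + (\<gamma> - 1) * (part_u \<eta> p - part_s \<sigma> p) - (part_t \<tau> p + part_s \<sigma> p)) * b powr (1 - \<gamma>)
      - \<gamma> * w * part_u \<sigma> p * b * b powr (1 - \<gamma>) - (part_t B1 p + part_s B2 p) - part_u B2 p * b)"
proof -
  have "b > 0" using assms by (auto simp: jet_dom_def)
  then have pw: "b powr (1 - \<gamma>) = b * b powr (- \<gamma>)"
    by (simp add: powr_diff powr_minus field_simps)
  have xi: "xi_t X = (\<lambda>j. \<tau> (base j))" "xi_s X = (\<lambda>j. \<sigma> (base j))" "eta X = (\<lambda>j. \<eta> (base j))"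
    by (auto simp: xi_t_def xi_s_def eta_def assms(1-3))
  \<comment> \<open>All derivatives are abstracted to free real variables, with \<open>R\<close> for
    \<open>b powr (- \<gamma>)\<close> and \<open>b * R\<close> for
    \<open>b powr (1 - \<gamma>)\<close>. What remains is a polynomial identity.\<close>
  have ring: "T * 0 + G * - (qs * w * (b * R)) + H * - (nu * w * (b * R))
      + (Ht + a * Hu - a * (Tt + a * Tu) - b * (Gt + a * Gu)) * a
      + (Hs + b * Hu - a * (Ts + b * Tu) - b * (Gs + b * Gu)) * ((\<gamma> - 1) * w * R)
      + (a\<^sup>2 / 2 - w * (b * R)) * (Tt + a * Tu + (Gs + b * Gu))
      - (B1t + a * B1u + (B2s + b * B2u)) =
    - Tu / 2 * a ^ 3 + (Hu - Tt / 2 + Gs / 2 - Gu / 2 * b) * a\<^sup>2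
    + (Ht - B1u - Gt * b - (\<gamma> - 1) * w * Ts * R - \<gamma> * w * Tu * (b * R)) * a
    + ((\<gamma> - 1) * w * Hs * R
      + w * (- (G * qs + H * nu) + (\<gamma> - 1) * (Hu - Gs) - (Tt + Gs)) * (b * R)
      - \<gamma> * w * Gu * b * (b * R) - (B1t + B2s) - B2u * b)"
    for T G H qs nu R Ht Hu Hs Tt Tu Ts Gt Gs Gu B1t B1u B2s B2u :: real
    by (simp add: field_simps power2_eq_square power3_eq_cube)
  show ?thesis
    unfolding prolong1_def zeta_t_def zeta_s_def pd_gas_L[OF assms(4)] xi D_t_base D_s_base gas_L_W
      p_def[symmetric] a_def[symmetric] b_def[symmetric] w_def[symmetric] pw
    by (rule ring)
qed

end

section \<open>The determining equations\<close>

context power_entropy_gas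
begin

text \<open>The last equation is the coefficient of \<open>b powr (1 - \<gamma>)\<close> divided by
  \<open>W\<close>. For \<open>n = 0\<close> its quotient by \<phi> has numerator 0 and is therefore
  0 even at \<phi> = 0.\<close>

definition determining :: "vfield \<Rightarrow> (real \<times> real \<times> real \<Rightarrow> real) \<Rightarrow> (real \<times> real \<times> real \<Rightarrow> real)
    \<Rightarrow> real \<times> real \<times> real \<Rightarrow> bool"
  where "determining X B1 B2 p \<longleftrightarrow>
    (let \<tau> = \<lambda>p. fst (X p); \<sigma> = \<lambda>p. fst (snd (X p)); \<eta> = \<lambda>p. snd (snd (X p)) in
      part_s \<tau> p = 0 \<and> part_u \<tau> p = 0 \<and> part_t \<sigma> p = 0 \<and> part_u \<sigma> p = 0 \<and> part_s \<eta> p = 0 \<and>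
      2 * part_u \<eta> p = part_t \<tau> p - part_s \<sigma> p \<and>
      part_t \<eta> p = part_u B1 p \<and> part_t B1 p + part_s B2 p = 0 \<and> part_u B2 p = 0 \<and>
      \<sigma> p * (q / fst (snd p)) + \<eta> p * (real n * (1 - \<gamma>) / snd (snd p))
        = (\<gamma> - 1) * (part_u \<eta> p - part_s \<sigma> p) - (part_t \<tau> p + part_s \<sigma> p))"

text \<open>Above each base point the jets realise every real \<open>a\<close> and every positive
  \<open>b\<close>, so the powers can be separated. The converse is substitution into
  \<open>noether_residual\<close>.\<close>

lemma noether_identity_iff_determining:
  "(\<forall>j\<in>jet_dom n. prolong1 X (gas_L n \<gamma> S) j
      + gas_L n \<gamma> S j * (D_t (xi_t X) j + D_s (xi_s X) j)
      = D_t (\<lambda>j. B1 (base j)) j + D_s (\<lambda>j. B2 (base j)) j) \<longleftrightarrow>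
    (\<forall>p\<in>base_dom n. determining X B1 B2 p)" (is "?L \<longleftrightarrow> ?R")
proof
  assume L: ?L
  show ?R
  proof
    fix p assume p: "p \<in> base_dom n"
    obtain t s u where tsu: "p = (t, s, u)" by (cases p)
    define w where "w = W s u"
    have w: "w > 0" using W_pos p unfolding tsu w_def by blast
    let ?\<tau> = "\<lambda>p. fst (X p)" and ?\<sigma> = "\<lambda>p. fst (snd (X p))" and ?\<eta> = "\<lambda>p. snd (snd (X p))"
    define K where "K = - (?\<sigma> p * (q / s) + ?\<eta> p * (real n * (1 - \<gamma>) / u))
          + (\<gamma> - 1) * (part_u ?\<eta> p - part_s ?\<sigma> p) - (part_t ?\<tau> p + part_s ?\<sigma> p)"
    have "- part_u ?\<tau> p / 2 * a ^ 3
      + (part_u ?\<eta> p - part_t ?\<tau> p / 2 + part_s ?\<sigma> p / 2 - part_u ?\<sigma> p / 2 * b) * a\<^sup>2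
      + (part_t ?\<eta> p - part_u B1 p - part_t ?\<sigma> p * b - (\<gamma> - 1) * w * part_s ?\<tau> p * b powr (- \<gamma>)
          - \<gamma> * w * part_u ?\<tau> p * b powr (1 - \<gamma>)) * a
      + ((\<gamma> - 1) * w * part_s ?\<eta> p * b powr (- \<gamma>) + w * K * b powr (1 - \<gamma>)
        - \<gamma> * w * part_u ?\<sigma> p * b * b powr (1 - \<gamma>) - (part_t B1 p + part_s B2 p) - part_u B2 p * b)
      = 0" if "b > 0" for a b
    proof -
      \<comment> \<open>The second-order coordinates do not enter the Noether condition, so they may
        be set to 0.\<close>
      define j where "j = \<lparr>jt = t, js = s, ju = u, jut = a, jus = b, jutt = 0, juts = 0, juss = 0\<rparr>"
      have j: "base j = p" "js j = s" "ju j = u" "jut j = a" "jus j = b"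
        by (simp_all add: j_def base_def tsu)
      then have "j \<in> jet_dom n" using p that by (simp add: jet_dom_def)
      from noether_residual[OF this, of X B1 B2] L this show ?thesis
        unfolding j w_def K_def by simp
    qed
    note * = cubic_vanishes[OF this]
    have \<tau>u: "part_u ?\<tau> p = 0" using *[of 1] by simp
    have 2: "part_u ?\<eta> p - part_t ?\<tau> p / 2 + part_s ?\<sigma> p / 2 - part_u ?\<sigma> p / 2 * b = 0"
      if "b > 0" for b using *[OF that] by blast
    \<comment> \<open>The order matters: the coefficient of \<open>a\<^sup>2\<close> is affine in
      \<open>b\<close>, and its vanishing at two values gives \<sigma>_u = 0. This removes the power
      with exponent 2 - \<gamma> from the \<open>a\<close>-free part before its remaining powers are
      separated.\<close>
    from 2[of 1] 2[of 2] have \<sigma>u: "part_u ?\<sigma> p = 0"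
      and \<eta>u: "2 * part_u ?\<eta> p = part_t ?\<tau> p - part_s ?\<sigma> p" by auto
    have "- ((\<gamma> - 1) * w * part_s ?\<tau> p) * b powr (- \<gamma>) + 0 * b powr (1 - \<gamma>)
        + (part_t ?\<eta> p - part_u B1 p) + - part_t ?\<sigma> p * b = 0" if "b > 0" for b
      using *[OF that] \<tau>u by (simp add: algebra_simps)
    note 1 = four_powers_independent[OF gamma this]
    have "(\<gamma> - 1) * w * part_s ?\<eta> p * b powr (- \<gamma>) + w * K * b powr (1 - \<gamma>)
        + - (part_t B1 p + part_s B2 p) + - part_u B2 p * b = 0" if "b > 0" for b
      using *[OF that] \<sigma>u by (simp add: algebra_simps)
    note 0 = four_powers_independent[OF gamma this]
    show "determining X B1 B2 p"
      using \<tau>u \<sigma>u \<eta>u 0 1 w gamma unfolding determining_def Let_def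
      by (auto simp: K_def tsu)
  qed
next
  assume R: ?R
  show ?L
  proof
    fix j assume j: "j \<in> jet_dom n"
    then have "determining X B1 B2 (base j)" using R by (auto simp: jet_dom_def)
    then have d: "determining X B1 B2 (base j)" .
    define p where "p = base j"
    let ?\<tau> = "\<lambda>p. fst (X p)" and ?\<sigma> = "\<lambda>p. fst (snd (X p))" and ?\<eta> = "\<lambda>p. snd (snd (X p))"
    define c2 where "c2 = part_u ?\<eta> p - part_t ?\<tau> p / 2 + part_s ?\<sigma> p / 2 - part_u ?\<sigma> p / 2 * jus j"
    define K where "K = - (?\<sigma> p * (q / js j) + ?\<eta> p * (real n * (1 - \<gamma>) / ju j))
          + (\<gamma> - 1) * (part_u ?\<eta> p - part_s ?\<sigma> p) - (part_t ?\<tau> p + part_s ?\<sigma> p)"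
    have js: "fst (snd p) = js j" "snd (snd p) = ju j" by (simp_all add: p_def base_def)
    have d': "part_s ?\<tau> p = 0" "part_u ?\<tau> p = 0" "part_t ?\<sigma> p = 0" "part_u ?\<sigma> p = 0"
      "part_s ?\<eta> p = 0" "part_t ?\<eta> p = part_u B1 p" "part_t B1 p + part_s B2 p = 0"
      "part_u B2 p = 0" "c2 = 0" "K = 0"
      using d unfolding p_def[symmetric] determining_def Let_def js c2_def K_def by auto
    have "prolong1 X (gas_L n \<gamma> S) j + gas_L n \<gamma> S j * (D_t (xi_t X) j + D_s (xi_s X) j)
        - (D_t (\<lambda>j. B1 (base j)) j + D_s (\<lambda>j. B2 (base j)) j) =
      - part_u ?\<tau> p / 2 * jut j ^ 3 + c2 * (jut j)\<^sup>2
      + (part_t ?\<eta> p - part_u B1 p - part_t ?\<sigma> p * jus j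
          - (\<gamma> - 1) * W (js j) (ju j) * part_s ?\<tau> p * jus j powr (- \<gamma>)
          - \<gamma> * W (js j) (ju j) * part_u ?\<tau> p * jus j powr (1 - \<gamma>)) * jut j
      + ((\<gamma> - 1) * W (js j) (ju j) * part_s ?\<eta> p * jus j powr (- \<gamma>)
        + W (js j) (ju j) * K * jus j powr (1 - \<gamma>)
        - \<gamma> * W (js j) (ju j) * part_u ?\<sigma> p * jus j * jus j powr (1 - \<gamma>)
        - (part_t B1 p + part_s B2 p) - part_u B2 p * jus j)"
      unfolding c2_def K_def p_def by (rule noether_residual[OF j])
    then show "prolong1 X (gas_L n \<gamma> S) j + gas_L n \<gamma> S j * (D_t (xi_t X) j + D_s (xi_s X) j)
      = D_t (\<lambda>j. B1 (base j)) j + D_s (\<lambda>j. B2 (base j)) j"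
      unfolding d' by simp
  qed
qed

lemma noether_symmetry_with_iff_determining:
  "noether_symmetry_with n (gas_L n \<gamma> S) X B1 B2 \<longleftrightarrow>
    smooth_on (base_dom n) X \<and> smooth_on (base_dom n) B1 \<and> smooth_on (base_dom n) B2 \<and>
    (\<forall>p\<in>base_dom n. determining X B1 B2 p)"
  unfolding noether_symmetry_with_def noether_identity_iff_determining[of X B1 B2] by (rule refl)

text \<open>The parameters are the coefficients of the following fields: \<open>k0\<close> of the
  time translation, \<open>k1 / 2\<close> and \<open>k2\<close> of the two generators special to
  \<open>gamma_star n\<close>, \<open>c\<close> of the scaling (0, s, -u/2), and \<open>h0\<close>,
  \<open>h1\<close> of (0, 0, 1) and (0, 0, t).\<close>

definition sym_field :: "real \<Rightarrow> real \<Rightarrow> real \<Rightarrow> real \<Rightarrow> real \<Rightarrow> real \<Rightarrow> vfield"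
  where "sym_field k0 k1 k2 c h0 h1 = (\<lambda>(t, s, u).
    (k0 + k1 * t + k2 * t\<^sup>2, c * s, ((k1 - c) / 2 + k2 * t) * u + h0 + h1 * t))"

definition \<alpha> :: real where "\<alpha> = (real n + 3) * \<gamma> + 2 * q - real n - 1"
definition \<beta> :: real where "\<beta> = (real n + 1) * \<gamma> - real n - 3"

lemma smooth_on_sym_field: "smooth_on U (sym_field k0 k1 k2 c h0 h1)"
  unfolding sym_field_def case_prod_beta' power2_eq_square
  by (intro smooth_on_Pair smooth_on_add smooth_on_mult smooth_on_const smooth_on_bounded_linear
      bounded_linear_intros)

text \<open>The first potential is an antiderivative in \<open>u\<close> of \<eta>_t =
  \<open>k2 * u + h1\<close>. It is independent of \<open>t\<close>, so the second one can be 0. For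
  \<open>k2 = h1 = 0\<close> both vanish and the symmetry is variational.\<close>

lemma noether_symmetry_with_sym_field:
  assumes "n \<ge> 1 \<longrightarrow> h0 = 0 \<and> h1 = 0" and "k1 * \<beta> = c * \<alpha>" and "k2 * \<beta> = 0"
  shows "noether_symmetry_with n (gas_L n \<gamma> S) (sym_field k0 k1 k2 c h0 h1)
    (\<lambda>(t, s, u). k2 / 2 * u\<^sup>2 + h1 * u) (\<lambda>_. 0)"
proof -
  have W: "\<sigma> * (q / s) + \<eta> * (real n * (1 - \<gamma>) / u)
      = (\<gamma> - 1) * (((k1 - c) / 2 + k2 * t) - c) - (k1 + 2 * k2 * t + c)"
    if "(t, s, u) \<in> base_dom n" "\<sigma> = c * s" "\<eta> = ((k1 - c) / 2 + k2 * t) * u + h0 + h1 * t"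
    for t s u \<sigma> \<eta>
  proof -
    have s: "s > 0" using that(1) by (simp add: base_dom_def)
    \<comment> \<open>For \<open>n \<ge> 1\<close> the constants \<open>h0\<close>,
      \<open>h1\<close> vanish and \<open>u > 0\<close> cancels; for \<open>n = 0\<close> both sides
      are 0 whatever \<open>u\<close> is.\<close>
    have "\<eta> * (real n * (1 - \<gamma>) / u) = ((k1 - c) / 2 + k2 * t) * (real n * (1 - \<gamma>))"
      unfolding that(3) using assms(1) that(1) by (cases "n = 0") (auto simp: base_dom_def)
    moreover have "\<sigma> * (q / s) = c * q" using s that(2) by simp
    moreover have "(k1 + 2 * k2 * t) * \<beta> = c * \<alpha>"
      using assms(2,3) by (auto simp: distrib_right)
    ultimately show ?thesis
      by (simp add: \<alpha>_def \<beta>_def field_simps)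
  qed
  have "determining (sym_field k0 k1 k2 c h0 h1) (\<lambda>(t, s, u). k2 / 2 * u\<^sup>2 + h1 * u) (\<lambda>_. 0) p"
    if p: "p \<in> base_dom n" for p
  proof -
    obtain t s u where tsu: "p = (t, s, u)" by (cases p)
    have d: "deriv (\<lambda>x. k0 + k1 * x + k2 * x\<^sup>2) t = k1 + 2 * k2 * t" "deriv (\<lambda>x. c * x) s = c"
      "deriv (\<lambda>x. ((k1 - c) / 2 + k2 * t) * x + h0 + h1 * t) u = ((k1 - c) / 2 + k2 * t)"
      "deriv (\<lambda>x. ((k1 - c) / 2 + k2 * x) * u + h0 + h1 * x) t = k2 * u + h1"
      "deriv (\<lambda>x. k2 * x\<^sup>2 / 2 + h1 * x) u = k2 * u + h1"
      by (rule DERIV_imp_deriv; auto intro!: derivative_eq_intros)+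
    show ?thesis
      unfolding determining_def Let_def tsu sym_field_def using W[OF p[unfolded tsu] refl refl]
      by (simp add: d)
  qed
  moreover have "smooth_on (base_dom n) (\<lambda>(t, s, u). k2 / 2 * u\<^sup>2 + h1 * u :: real)"
    unfolding case_prod_beta' power2_eq_square
    by (intro smooth_on_add smooth_on_mult smooth_on_const smooth_on_bounded_linear
        bounded_linear_intros)
  ultimately show ?thesis
    unfolding noether_symmetry_with_iff_determining
    by (blast intro: smooth_on_sym_field smooth_on_const)
qed

end

section \<open>Solving the determining equations\<close>

declare part_t.simps [simp del] part_s.simps [simp del] part_u.simps [simp del]

lemma DERIV_zero_imp_constant_on:
  fixes f :: "real \<Rightarrow> real"
  assumes "convex I" and "\<And>x. x \<in> I \<Longrightarrow> (f has_real_derivative 0) (at x)" and "x \<in> I" "y \<in> I"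
  shows "f x = f y"
  using has_field_derivative_zero_constant[of I f] assms
  by (metis has_field_derivative_at_within)

context power_entropy_gas
begin

text \<open>The equations are integrated one variable at a time. The zero partial derivatives leave
  \<tau>(t), \<sigma>(s) and \<eta>(t, u); separating variables in 2 \<eta>_u = \<tau>_t -
  \<sigma>_s makes \<sigma> affine in s and \<eta> affine in u; the potentials make \<eta> affine in
  t, hence \<tau> quadratic.\<close>

lemma determining_imp_sym_field:
  fixes X :: vfield
  assumes q: "q \<noteq> 0"
    and dX: "\<And>p. p \<in> base_dom n \<Longrightarrow> X differentiable (at p)"
    and dB1: "\<And>p. p \<in> base_dom n \<Longrightarrow> B1 differentiable (at p)"
    and dB2: "\<And>p. p \<in> base_dom n \<Longrightarrow> B2 differentiable (at p)"
    and det: "\<And>p. p \<in> base_dom n \<Longrightarrow> determining X B1 B2 p"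
  shows "\<exists>k0 k1 k2 c h0 h1. (\<forall>p\<in>base_dom n. X p = sym_field k0 k1 k2 c h0 h1 p)
    \<and> (n \<ge> 1 \<longrightarrow> h0 = 0 \<and> h1 = 0) \<and> k1 * \<beta> = c * \<alpha> \<and> k2 * \<beta> = 0"
proof -
  \<comment> \<open>The range of \<phi> is a half-line or the whole line. The domain is then a
    product of intervals, with convex slices on which a zero derivative forces a constant. The
    points 1 and 2 of \<open>U\<close> serve as samples in both cases.\<close>
  define U where "U = {u::real. n \<ge> 1 \<longrightarrow> u > 0}"
  have dom: "(t, s, u) \<in> base_dom n \<longleftrightarrow> s > 0 \<and> u \<in> U" for t s u
    by (auto simp: base_dom_def U_def)
  have U: "convex U" "open U"
  proof -
    have "U = (if n \<ge> 1 then {0<..} else UNIV)" by (auto simp: U_def)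
    then show "convex U" "open U" by simp_all
  qed
  have U12: "1 \<in> U" "2 \<in> U" by (auto simp: U_def)
  have pos: "convex {0::real<..}" by simp
  define \<tau> where "\<tau> = (\<lambda>p. fst (X p))"
  define \<sigma> where "\<sigma> = (\<lambda>p. fst (snd (X p)))"
  define \<eta> where "\<eta> = (\<lambda>p. snd (snd (X p)))"
  have diffs: "\<tau> differentiable (at p)" "\<sigma> differentiable (at p)" "\<eta> differentiable (at p)"
    if "p \<in> base_dom n" for p
  proof -
    from dX[OF that] obtain D where D: "(X has_derivative D) (at p)"
      unfolding differentiable_def by blast
    show "\<tau> differentiable (at p)" "\<sigma> differentiable (at p)" "\<eta> differentiable (at p)"
      unfolding \<tau>_def \<sigma>_def \<eta>_def
      by (rule differentiableI has_derivative_fst has_derivative_snd D)+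
  qed
  have D: "part_s \<tau> p = 0" "part_u \<tau> p = 0" "part_t \<sigma> p = 0" "part_u \<sigma> p = 0" "part_s \<eta> p = 0"
      "2 * part_u \<eta> p = part_t \<tau> p - part_s \<sigma> p" "part_t \<eta> p = part_u B1 p"
      "part_t B1 p + part_s B2 p = 0" "part_u B2 p = 0"
      "\<sigma> p * (q / fst (snd p)) + \<eta> p * (real n * (1 - \<gamma>) / snd (snd p))
        = (\<gamma> - 1) * (part_u \<eta> p - part_s \<sigma> p) - (part_t \<tau> p + part_s \<sigma> p)"
    if "p \<in> base_dom n" for p
    using det[OF that] unfolding determining_def Let_def \<tau>_def \<sigma>_def \<eta>_def by auto
  have const_t: "f (t, s, u) = f (t', s, u)"
    if "\<And>p. p \<in> base_dom n \<Longrightarrow> f differentiable (at p)" "\<And>p. p \<in> base_dom n \<Longrightarrow> part_t f p = 0"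
      "s > 0" "u \<in> U" for f :: "real \<times> real \<times> real \<Rightarrow> real" and t t' s u
  proof (rule DERIV_zero_imp_constant_on[of UNIV "\<lambda>x. f (x, s, u)"])
    fix x show "((\<lambda>x. f (x, s, u)) has_real_derivative 0) (at x)"
      using part_DERIV(1)[OF that(1), of x s u] that(2)[of "(x, s, u)"] that(3,4) dom by simp
  qed auto
  have const_s: "f (t, s, u) = f (t, s', u)"
    if "\<And>p. p \<in> base_dom n \<Longrightarrow> f differentiable (at p)" "\<And>p. p \<in> base_dom n \<Longrightarrow> part_s f p = 0"
      "s > 0" "s' > 0" "u \<in> U" for f :: "real \<times> real \<times> real \<Rightarrow> real" and t s s' u
  proof (rule DERIV_zero_imp_constant_on[OF pos, of "\<lambda>x. f (t, x, u)"])
    fix x :: real assume "x \<in> {0<..}"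
    then show "((\<lambda>x. f (t, x, u)) has_real_derivative 0) (at x)"
      using part_DERIV(2)[OF that(1), of t x u] that(2)[of "(t, x, u)"] that(5) dom by simp
  qed (use that in auto)
  have const_u: "f (t, s, u) = f (t, s, u')"
    if "\<And>p. p \<in> base_dom n \<Longrightarrow> f differentiable (at p)" "\<And>p. p \<in> base_dom n \<Longrightarrow> part_u f p = 0"
      "s > 0" "u \<in> U" "u' \<in> U" for f :: "real \<times> real \<times> real \<Rightarrow> real" and t s u u'
  proof (rule DERIV_zero_imp_constant_on[OF U(1), of "\<lambda>x. f (t, s, x)"])
    fix x :: real assume "x \<in> U"
    then show "((\<lambda>x. f (t, s, x)) has_real_derivative 0) (at x)"
      using part_DERIV(3)[OF that(1), of t s x] that(2)[of "(t, s, x)"] that(3) dom by simp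
  qed (use that in auto)
  define T G H where "T = (\<lambda>t. \<tau> (t, 1, 1))" and "G = (\<lambda>s. \<sigma> (0, s, 1))"
    and "H = (\<lambda>t u. \<eta> (t, 1, u))"
  have \<tau>T: "\<tau> p = (case p of (t, s, u) \<Rightarrow> T t)" if "p \<in> base_dom n" for p
  proof -
    obtain t s u where p: "p = (t, s, u)" "s > 0" "u \<in> U" using \<open>p \<in> base_dom n\<close> dom by (cases p) auto
    then have "\<tau> (t, s, u) = \<tau> (t, s, 1)" by (intro const_u[OF diffs(1) D(2)] U12)
    also have "\<dots> = \<tau> (t, 1, 1)" using p by (intro const_s[OF diffs(1) D(1)] U12) auto
    finally show ?thesis by (simp add: p T_def)
  qed
  have \<sigma>G: "\<sigma> p = (case p of (t, s, u) \<Rightarrow> G s)" if "p \<in> base_dom n" for p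
  proof -
    obtain t s u where p: "p = (t, s, u)" "s > 0" "u \<in> U" using \<open>p \<in> base_dom n\<close> dom by (cases p) auto
    then have "\<sigma> (t, s, u) = \<sigma> (t, s, 1)" by (intro const_u[OF diffs(2) D(4)] U12)
    also have "\<dots> = \<sigma> (0, s, 1)" using p by (intro const_t[OF diffs(2) D(3)] U12)
    finally show ?thesis by (simp add: p G_def)
  qed
  have \<eta>H: "\<eta> p = (case p of (t, s, u) \<Rightarrow> H t u)" if "p \<in> base_dom n" for p
  proof -
    obtain t s u where p: "p = (t, s, u)" "s > 0" "u \<in> U" using \<open>p \<in> base_dom n\<close> dom by (cases p) auto
    then have "\<eta> (t, s, u) = \<eta> (t, 1, u)" by (intro const_s[OF diffs(3) D(5)]) auto
    then show ?thesis by (simp add: p H_def)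
  qed
  have pt: "part_t \<tau> (t, s, u) = deriv T t" "part_s \<sigma> (t, s, u) = deriv G s"
    "part_u \<eta> (t, s, u) = deriv (H t) u" if "s > 0" "u \<in> U" for t s u
    using part_cong(1)[of n \<tau> "\<lambda>(t, s, u). T t" "(t, s, u)", OF \<tau>T]
      part_cong(2)[of n \<sigma> "\<lambda>(t, s, u). G s" "(t, s, u)", OF \<sigma>G]
      part_cong(3)[of n \<eta> "\<lambda>(t, s, u). H t u" "(t, s, u)", OF \<eta>H] that
    by (simp_all add: dom part_t.simps part_s.simps part_u.simps)
  have 1: "1 > (0::real)" by simp
  note d11 = dom[of _ 1 1, THEN iffD2, OF conjI, OF 1 U12(1)]
  have dT: "(T has_real_derivative deriv T t) (at t)" for t
    using part_DERIV(1)[OF diffs(1)[OF d11], of t] pt(1)[OF 1 U12(1)] by (simp add: T_def)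
  have dG: "(G has_real_derivative deriv G s) (at s)" if "s > 0" for s
    using part_DERIV(2)[OF diffs(2), of 0 s 1] pt(2)[OF that U12(1)] that U12
    by (simp add: G_def dom)
  have dH: "(H t has_real_derivative deriv (H t) u) (at u)" if "u \<in> U" for t u
    using part_DERIV(3)[OF diffs(3), of t 1 u] pt(3)[OF 1 that] that
    by (simp add: H_def dom)
  have HTG: "2 * deriv (H t) u = deriv T t - deriv G s" if "s > 0" "u \<in> U" for t s u
    using D(6)[of "(t, s, u)"] pt[OF that] that by (simp add: dom)
  define c where "c = deriv G 1"
  \<comment> \<open>At fixed \<open>t\<close> and \<open>u\<close> the other two terms of
    \<open>HTG\<close> do not depend on \<open>s\<close>.\<close>
  have G': "deriv G s = c" if "s > 0" for s
    using HTG[OF that U12(1), of 0] HTG[OF 1 U12(1), of 0] by (simp add: c_def)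
  have Hu: "deriv (H t) u = (deriv T t - c) / 2" if "u \<in> U" for t u
    using HTG[OF 1 that, of t] by (simp add: c_def)
  define c0 where "c0 = G 1 - c"
  have G: "G s = c * s + c0" if "s > 0" for s
  proof -
    have "((\<lambda>s. G s - c * s) has_real_derivative 0) (at s)" if "s > 0" for s
      using dG[OF that] G'[OF that] by (auto intro!: derivative_eq_intros)
    from DERIV_zero_imp_constant_on[OF pos this, of s 1] that show ?thesis
      by (simp add: c0_def)
  qed
  define h where "h t = H t 1 - (deriv T t - c) / 2" for t
  have H: "H t u = (deriv T t - c) / 2 * u + h t" if "u \<in> U" for t u
  proof -
    have "((\<lambda>u. H t u - (deriv T t - c) / 2 * u) has_real_derivative 0) (at u)" if "u \<in> U" for u
      using dH[OF that, of t] Hu[OF that, of t] by (auto intro!: derivative_eq_intros)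
    from DERIV_zero_imp_constant_on[OF U(1) this that U12(1)] show ?thesis
      by (simp add: h_def)
  qed
  have Weq: "(c * s + c0) * (q / s) + H t u * (real n * (1 - \<gamma>) / u)
      = (\<gamma> - 1) * ((deriv T t - c) / 2 - c) - (deriv T t + c)"
    if "s > 0" "u \<in> U" for t s u
    using D(10)[of "(t, s, u)"] that pt[OF that] G'[OF that(1)] G[OF that(1)] Hu[OF that(2)]
      \<sigma>G[of "(t, s, u)"] \<eta>H[of "(t, s, u)"] by (simp add: dom)
  \<comment> \<open>The only term of \<open>Weq\<close> that varies with \<open>s\<close> is
    \<open>c0 * q / s\<close>. As \<open>q \<noteq> 0\<close>, comparing \<open>s = 1\<close> with
    \<open>s = 2\<close> excludes translations in \<open>s\<close>.\<close>
  have c0: "c0 = 0"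
  proof -
    have "(c * 1 + c0) * (q / 1) = (c * 2 + c0) * (q / 2)"
      using Weq[of 1 1 0] Weq[of 2 1 0] U12(1) by linarith
    then show ?thesis using q by (simp add: field_simps)
  qed
  \<comment> \<open>\<open>B2\<close> does not depend on \<open>u\<close>, hence neither does its
    s-derivative, which is the negative of the t-derivative of \<open>B1\<close>.\<close>
  have B2: "part_s B2 (t, 1, u) = part_s B2 (t, 1, 1)" if "u \<in> U" for t u
  proof -
    have "B2 p = (case p of (t, s, u) \<Rightarrow> B2 (t, s, 1))" if "p \<in> base_dom n" for p
    proof -
      obtain t s u where p: "p = (t, s, u)" "s > 0" "u \<in> U" using \<open>p \<in> base_dom n\<close> dom by (cases p) auto
      then have "B2 (t, s, u) = B2 (t, s, 1)" by (intro const_u[OF dB2 D(9)] U12)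
      then show ?thesis by (simp add: p)
    qed
    from part_cong(2)[of n B2 "\<lambda>(t, s, u). B2 (t, s, 1)" "(t, 1, u)", OF this] that show ?thesis
      by (simp add: dom part_s.simps)
  qed
  have B1: "B1 (t, 1, u) = B1 (0, 1, u) + (B1 (t, 1, 1) - B1 (0, 1, 1))" if u: "u \<in> U" for t u
  proof -
    have "((\<lambda>x. B1 (x, 1, u) - B1 (x, 1, 1)) has_real_derivative 0) (at x)" for x
    proof (rule DERIV_cong[OF DERIV_diff[OF part_DERIV(1)[OF dB1] part_DERIV(1)[OF dB1]]])
      show "part_t B1 (x, 1, u) - part_t B1 (x, 1, 1) = 0"
        using D(8)[of "(x, 1, u)"] D(8)[of "(x, 1, 1)"] B2[OF u, of x] u U12 dom by force
    qed (use u U12 dom in auto)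
    from DERIV_zero_imp_constant_on[OF convex_UNIV this, of t 0] show ?thesis by simp
  qed
  \<comment> \<open>\<open>B1(t, 1, u) - B1(t, 1, 1)\<close> is constant in \<open>t\<close>, so \<open>\<eta>\<^sub>t = \<partial>\<^sub>u B1\<close> is too; no second derivatives are needed.\<close>
  define e where "e u = part_u B1 (0, 1, u)" for u
  have eta_t: "part_t \<eta> (t, 1, u) = e u" if u: "u \<in> U" for t u
  proof -
    have "((\<lambda>x. B1 (t, 1, x)) has_real_derivative e u) (at u)"
    proof (rule has_field_derivative_transform_within_open)
      show "((\<lambda>x. B1 (0, 1, x) + (B1 (t, 1, 1) - B1 (0, 1, 1))) has_real_derivative e u) (at u)"
        using part_DERIV(3)[OF dB1, of 0 1 u] u unfolding e_def
        by (auto intro!: derivative_eq_intros simp: dom)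
      fix x assume "x \<in> U"
      then show "B1 (0, 1, x) + (B1 (t, 1, 1) - B1 (0, 1, 1)) = B1 (t, 1, x)"
        by (rule B1[symmetric])
    qed (rule U u)+
    then show ?thesis
      using D(7)[of "(t, 1, u)"] u by (simp add: dom part_u.simps DERIV_imp_deriv)
  qed
  have Ht: "H t u = H 0 u + e u * t" if u: "u \<in> U" for t u
  proof -
    have "((\<lambda>x. H x u - e u * x) has_real_derivative 0) (at x)" for x
      using part_DERIV(1)[OF diffs(3), of x 1 u] eta_t[OF u, of x] u unfolding H_def
      by (auto intro!: derivative_eq_intros simp: dom)
    from DERIV_zero_imp_constant_on[OF convex_UNIV this, of t 0] show ?thesis by simp
  qed
  \<comment> \<open>\<open>H t 2 - H t 1\<close> equals \<open>(deriv T t - c) / 2\<close> and is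
    affine in \<open>t\<close> by \<open>Ht\<close>; the constants are read off from these two
    expressions.\<close>
  define k1 k2 where "k1 = 2 * (H 0 2 - H 0 1) + c" and "k2 = e 2 - e 1"
  have T': "deriv T t = k1 + 2 * k2 * t" for t
    using H[OF U12(1), of t] H[OF U12(2), of t] Ht[OF U12(1), of t] Ht[OF U12(2), of t]
    by (simp add: k1_def k2_def field_simps)
  have T: "T t = T 0 + k1 * t + k2 * t\<^sup>2" for t
  proof -
    have "((\<lambda>x. T x - k1 * x - k2 * x\<^sup>2) has_real_derivative 0) (at x)" for x
      using dT[of x] T'[of x] by (auto intro!: derivative_eq_intros)
    from DERIV_zero_imp_constant_on[OF convex_UNIV this, of t 0] show ?thesis by simp
  qed
  define h0 h1 where "h0 = H 0 1 - (k1 - c) / 2" and "h1 = e 1 - k2"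
  have h: "h t = h0 + h1 * t" for t
    using Ht[OF U12(1), of t] by (simp add: h_def T' h0_def h1_def field_simps)
  have XV: "X p = sym_field (T 0) k1 k2 c h0 h1 p" if "p \<in> base_dom n" for p
  proof -
    obtain t s u where tsu: "p = (t, s, u)" by (cases p)
    have "X p = (\<tau> p, \<sigma> p, \<eta> p)" by (simp add: \<tau>_def \<sigma>_def \<eta>_def)
    moreover have "s > 0" "u \<in> U" using that tsu dom by auto
    ultimately show ?thesis
      using \<tau>T[OF that] \<sigma>G[OF that] \<eta>H[OF that] T[of t] G[of s] H[of u t]
      by (simp add: tsu sym_field_def c0 T' h field_simps)
  qed
  have hn: "h0 = 0 \<and> h1 = 0" if n: "n \<ge> 1"
  proof -
    \<comment> \<open>For \<open>n \<ge> 1\<close> equation \<open>Weq\<close> forces \<eta> / u to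
      be the same at \<open>u = 1\<close> and \<open>u = 2\<close>, so the part of \<eta>
      independent of \<open>u\<close> vanishes.\<close>
    have "h t = 0" for t
    proof -
      define N where "N = real n * (1 - \<gamma>)"
      have "H t 1 * (N / 1) = H t 2 * (N / 2)"
        using Weq[of 1 1 t] Weq[of 1 2 t] U12 unfolding N_def by linarith
      then have "h t * N = 0" using H[OF U12(1), of t] H[OF U12(2), of t] by (simp add: field_simps)
      then show ?thesis using n gamma by (simp add: N_def)
    qed
    from this[of 0] this[of 1] show ?thesis by (simp add: h)
  qed
  \<comment> \<open>\<open>Weq\<close> at \<open>s = u = 1\<close> is an identity in
    \<open>t\<close>, so both coefficients can be compared.\<close>
  have "(k1 + 2 * k2 * t) * \<beta> = c * \<alpha>" for t
  proof -
    have "H t 1 * (real n * (1 - \<gamma>)) = (deriv T t - c) / 2 * (real n * (1 - \<gamma>))"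
      unfolding H[OF U12(1), of t] using hn h[of t] by (cases "n = 0") auto
    then show ?thesis
      using Weq[OF 1 U12(1), of t] by (simp add: c0 T' \<alpha>_def \<beta>_def field_simps)
  qed
  from this[of 0] this[of 1] have "k1 * \<beta> = c * \<alpha>" "k2 * \<beta> = 0" by (auto simp: algebra_simps)
  with XV hn show ?thesis by blast
qed

text \<open>For the converse \<open>X\<close> agrees with a \<open>sym_field\<close> only on
  \<open>base_dom n\<close>. This set is open, so smoothness and the determining equations carry
  over with the same potentials.\<close>

lemma noether_symmetry_iff:
  assumes "q \<noteq> 0"
  shows "noether_symmetry n (gas_L n \<gamma> S) X \<longleftrightarrow>
    (\<exists>k0 k1 k2 c h0 h1. (\<forall>p\<in>base_dom n. X p = sym_field k0 k1 k2 c h0 h1 p)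
      \<and> (n \<ge> 1 \<longrightarrow> h0 = 0 \<and> h1 = 0) \<and> k1 * \<beta> = c * \<alpha> \<and> k2 * \<beta> = 0)" (is "?L \<longleftrightarrow> ?R")
proof
  assume ?L
  then obtain B1 B2 where "noether_symmetry_with n (gas_L n \<gamma> S) X B1 B2"
    by (auto simp: noether_symmetry_def)
  then show ?R
    unfolding noether_symmetry_with_iff_determining
    by (intro determining_imp_sym_field[OF assms, of X B1 B2]) (auto intro: smooth_on_imp_differentiable)
next
  assume ?R
  then obtain k0 k1 k2 c h0 h1 where X: "\<And>p. p \<in> base_dom n \<Longrightarrow> sym_field k0 k1 k2 c h0 h1 p = X p"
    and *: "n \<ge> 1 \<longrightarrow> h0 = 0 \<and> h1 = 0" "k1 * \<beta> = c * \<alpha>" "k2 * \<beta> = 0" by auto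
  define B1 where "B1 = (\<lambda>(t::real, s::real, u). k2 / 2 * u\<^sup>2 + h1 * u)"
  have sym_field: "noether_symmetry_with n (gas_L n \<gamma> S) (sym_field k0 k1 k2 c h0 h1) B1 (\<lambda>_. 0)"
    unfolding B1_def by (rule noether_symmetry_with_sym_field[OF *])
  have "determining (sym_field k0 k1 k2 c h0 h1) B1 (\<lambda>_. 0) p = determining X B1 (\<lambda>_. 0) p"
    if p: "p \<in> base_dom n" for p
  proof -
    have f: "fst (sym_field k0 k1 k2 c h0 h1 p) = fst (X p)"
        "fst (snd (sym_field k0 k1 k2 c h0 h1 p)) = fst (snd (X p))"
        "snd (snd (sym_field k0 k1 k2 c h0 h1 p)) = snd (snd (X p))" if "p \<in> base_dom n" for p
      using X[OF that] by auto
    show ?thesis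
      unfolding determining_def Let_def
      by (simp only: X[OF p] part_cong[OF f(1) p] part_cong[OF f(2) p] part_cong[OF f(3) p])
  qed
  moreover have "smooth_on (base_dom n) X"
    using smooth_on_cong[OF open_base_dom X smooth_on_sym_field] by blast
  ultimately have "noether_symmetry_with n (gas_L n \<gamma> S) X B1 (\<lambda>_. 0)"
    using sym_field unfolding noether_symmetry_with_iff_determining by blast
  then show ?L by (auto simp: noether_symmetry_def)
qed

end

section \<open>Spans and point symmetries\<close>

lemma sum_length_Cons:
  "(\<Sum>i<length (Y # Ys). c i *\<^sub>R ((Y # Ys) ! i) p)
    = c 0 *\<^sub>R Y p + (\<Sum>i<length Ys. c (Suc i) *\<^sub>R (Ys ! i) p)"
  for Y :: vfield
  by (simp add: sum.lessThan_Suc_shift del: sum.lessThan_Suc)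

lemma sum_length_Nil: "(\<Sum>i<length []. c i *\<^sub>R ([] ! i) p) = 0" for p :: "real \<times> real \<times> real"
  by simp

lemma in_span_append_single:
  "in_span n (Xs @ [Z]) X \<longleftrightarrow> (\<exists>d. in_span n Xs (\<lambda>p. X p - d *\<^sub>R Z p))"
proof
  assume "in_span n (Xs @ [Z]) X"
  then obtain c where c: "\<And>p. p \<in> base_dom n \<Longrightarrow>
      X p = (\<Sum>i<length (Xs @ [Z]). c i *\<^sub>R ((Xs @ [Z]) ! i) p)"
    unfolding in_span_def by blast
  have "(\<Sum>i<length Xs. c i *\<^sub>R ((Xs @ [Z]) ! i) p) = (\<Sum>i<length Xs. c i *\<^sub>R (Xs ! i) p)" for p
    by (intro sum.cong) (auto simp: nth_append)
  then have "in_span n Xs (\<lambda>p. X p - c (length Xs) *\<^sub>R Z p)"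
    unfolding in_span_def by (intro exI[of _ c]) (simp add: c)
  then show "\<exists>d. in_span n Xs (\<lambda>p. X p - d *\<^sub>R Z p)" ..
next
  assume "\<exists>d. in_span n Xs (\<lambda>p. X p - d *\<^sub>R Z p)"
  then obtain d c where c: "\<And>p. p \<in> base_dom n \<Longrightarrow>
      X p - d *\<^sub>R Z p = (\<Sum>i<length Xs. c i *\<^sub>R (Xs ! i) p)"
    unfolding in_span_def by blast
  define c' where "c' i = (if i < length Xs then c i else d)" for i
  have "(\<Sum>i<length Xs. c' i *\<^sub>R ((Xs @ [Z]) ! i) p) = (\<Sum>i<length Xs. c i *\<^sub>R (Xs ! i) p)" for p
    by (intro sum.cong) (auto simp: nth_append c'_def)
  then show "in_span n (Xs @ [Z]) X"
    unfolding in_span_def by (intro exI[of _ c']) (simp add: c[symmetric] c'_def)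
qed

section \<open>Prolongations depend only on values over the domain\<close>

lemma pd_cong_jet_dom:
  assumes "\<And>j. j \<in> jet_dom n \<Longrightarrow> F j = G j" and "j \<in> jet_dom n"
  shows "pd_t F j = pd_t G j" "pd_s F j = pd_s G j" "pd_u F j = pd_u G j"
    "pd_ut F j = pd_ut G j" "pd_us F j = pd_us G j"
proof -
  have j: "(jt j, js j, ju j) \<in> base_dom n" "jus j > 0"
    using assms(2) by (auto simp: jet_dom_def base_def)
  note ev = eventually_base_dom[OF j(1)] eventually_nhds_in_open[of "{0<..}" "jus j"]
  show "pd_t F j = pd_t G j" "pd_s F j = pd_s G j" "pd_u F j = pd_u G j"
    unfolding pd_t_def pd_s_def pd_u_def using j(2)
    by (intro deriv_cong_ev eventually_mono[OF ev(1)] eventually_mono[OF ev(2)]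
        eventually_mono[OF ev(3)] assms(1) refl; simp add: jet_dom_def base_def)+
  show "pd_ut F j = pd_ut G j"
    unfolding pd_ut_def using j
    by (intro deriv_cong_ev always_eventually allI assms(1) refl) (simp add: jet_dom_def base_def)
  show "pd_us F j = pd_us G j"
    unfolding pd_us_def using j
    by (intro deriv_cong_ev eventually_mono[OF ev(4)] assms(1) refl)
      (simp_all add: jet_dom_def base_def)
qed

lemma D_cong_jet_dom:
  assumes "\<And>j. j \<in> jet_dom n \<Longrightarrow> F j = G j" and "j \<in> jet_dom n"
  shows "D_t F j = D_t G j" "D_s F j = D_s G j"
  unfolding D_t_def D_s_def by (simp_all add: pd_cong_jet_dom[OF assms])

text \<open>The second prolongation differentiates \<open>zeta_t\<close> and \<open>zeta_s\<close>,
  so these have to be matched on all of \<open>jet_dom n\<close> before the derivatives at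
  \<open>j\<close> can be.\<close>

lemma prolong2_cong:
  assumes XY: "\<And>p. p \<in> base_dom n \<Longrightarrow> X p = Y p" and j: "j \<in> jet_dom n"
  shows "prolong2 X F j = prolong2 Y F j"
proof -
  have xi: "xi_t X j = xi_t Y j" "xi_s X j = xi_s Y j" "eta X j = eta Y j"
    if "j \<in> jet_dom n" for j
    using that XY[of "base j"] by (simp_all add: xi_t_def xi_s_def eta_def jet_dom_def)
  have D: "D_t (xi_t X) j = D_t (xi_t Y) j" "D_s (xi_t X) j = D_s (xi_t Y) j"
    "D_t (xi_s X) j = D_t (xi_s Y) j" "D_s (xi_s X) j = D_s (xi_s Y) j"
    "D_t (eta X) j = D_t (eta Y) j" "D_s (eta X) j = D_s (eta Y) j" if "j \<in> jet_dom n" for j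
    using xi that by (auto intro!: D_cong_jet_dom[of n])
  have zeta: "zeta_t X j = zeta_t Y j" "zeta_s X j = zeta_s Y j" if "j \<in> jet_dom n" for j
    unfolding zeta_t_def zeta_s_def using D[OF that] by simp_all
  have D2: "D_t (zeta_t X) j = D_t (zeta_t Y) j" "D_s (zeta_t X) j = D_s (zeta_t Y) j"
    "D_s (zeta_s X) j = D_s (zeta_s Y) j"
    using zeta j by (auto intro!: D_cong_jet_dom[of n])
  show ?thesis
    unfolding prolong2_def prolong1_def zeta_tt_def zeta_ts_def zeta_ss_def
    using xi[OF j] zeta[OF j] D[OF j] D2 by simp
qed

context power_entropy_gas
begin

lemma beta_0_iff: "\<beta> = 0 \<longleftrightarrow> \<gamma> = gamma_star n"
  by (auto simp: \<beta>_def gamma_star_def field_simps)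

lemma alpha_0_iff: "\<beta> = 0 \<Longrightarrow> \<alpha> = 0 \<longleftrightarrow> q = q_star n"
proof -
  assume "\<beta> = 0"
  then have g: "\<gamma> * (real n + 1) = real n + 3" by (simp add: \<beta>_def algebra_simps)
  \<comment> \<open>Multiplying by \<open>n + 1\<close> makes \<gamma> occur only in the product
    \<open>\<gamma> * (n + 1)\<close>, whose value is \<open>g\<close>.\<close>
  have "(\<alpha> = 0) = ((real n + 1) * \<alpha> = 0)" by simp
  also have "(real n + 1) * \<alpha> = (real n + 3) * (\<gamma> * (real n + 1)) + (2 * q - real n - 1) * (real n + 1)"
    by (simp add: \<alpha>_def algebra_simps)
  also have "\<dots> = 2 * (q * (real n + 1) + 2 * (real n + 2))"
    unfolding g by (simp add: algebra_simps)
  also have "(\<dots> = 0) = (q = q_star n)"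
    by (auto simp: q_star_def field_simps)
  finally show ?thesis .
qed

text \<open>The listed generators are the slice \<open>c = 0\<close> of the family
  \<open>sym_field\<close>. The side conditions mirror the list: \<open>h0\<close>,
  \<open>h1\<close> are available only for \<open>n = 0\<close>, and \<open>k1\<close>,
  \<open>k2\<close> only for \<beta> = 0.\<close>

lemma in_span_arbitrary_entropy_iff:
  "in_span n (arbitrary_entropy_symmetries n \<gamma>) X \<longleftrightarrow>
    (\<exists>k0 k1 k2 h0 h1. (\<forall>p\<in>base_dom n. X p = sym_field k0 k1 k2 0 h0 h1 p)
      \<and> (n \<ge> 1 \<longrightarrow> h0 = 0 \<and> h1 = 0) \<and> k1 * \<beta> = 0 \<and> k2 * \<beta> = 0)" (is "?L \<longleftrightarrow> ?R")
proof
  assume ?L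
  then obtain c where c: "\<And>p. p \<in> base_dom n \<Longrightarrow>
      X p = (\<Sum>i<length (arbitrary_entropy_symmetries n \<gamma>).
          c i *\<^sub>R (arbitrary_entropy_symmetries n \<gamma> ! i) p)"
    unfolding in_span_def by blast
  define h0 h1 where "h0 = (if n = 0 then c (Suc 0) else 0)"
    and "h1 = (if n = 0 then c (Suc (Suc 0)) else 0)"
  \<comment> \<open>For \<open>n = 0\<close> two generators precede the last pair, which shifts its
    indices by two. The factor 2 comes from the component \<open>2 * t\<close> of the first of that
    pair.\<close>
  define k1 where "k1 = (if \<beta> = 0 then 2 * c (if n = 0 then Suc (Suc (Suc 0)) else Suc 0) else 0)"
  define k2 where "k2 = (if \<beta> = 0 then c (if n = 0 then Suc (Suc (Suc (Suc 0))) else Suc (Suc 0)) else 0)"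
  have "X p = sym_field (c 0) k1 k2 0 h0 h1 p" if "p \<in> base_dom n" for p
    unfolding c[OF that] arbitrary_entropy_symmetries_def beta_0_iff[symmetric] append.simps
    by (cases p; cases "n = 0"; cases "\<beta> = 0")
      (simp_all add: sym_field_def h0_def h1_def k1_def k2_def sum_length_Cons sum_length_Nil zero_prod_def
        algebra_simps del: list.size sum.lessThan_Suc)
  moreover have "n \<ge> 1 \<longrightarrow> h0 = 0 \<and> h1 = 0" "k1 * \<beta> = 0" "k2 * \<beta> = 0"
    by (simp_all add: h0_def h1_def k1_def k2_def)
  ultimately show ?R by blast
next
  assume ?R
  then obtain k0 k1 k2 h0 h1 where X: "\<And>p. p \<in> base_dom n \<Longrightarrow> X p = sym_field k0 k1 k2 0 h0 h1 p"
    and *: "n \<ge> 1 \<longrightarrow> h0 = 0 \<and> h1 = 0" "k1 * \<beta> = 0" "k2 * \<beta> = 0" by blast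
  define cs where "cs = [k0] @ (if n = 0 then [h0, h1] else []) @ [k1 / 2, k2]"
  have "X p = (\<Sum>i<length (arbitrary_entropy_symmetries n \<gamma>).
      (cs ! i) *\<^sub>R (arbitrary_entropy_symmetries n \<gamma> ! i) p)" if "p \<in> base_dom n" for p
    unfolding X[OF that] arbitrary_entropy_symmetries_def beta_0_iff[symmetric] cs_def
    using * by (cases p; cases "n = 0"; cases "\<beta> = 0")
      (simp_all add: sym_field_def sum_length_Cons sum_length_Nil zero_prod_def algebra_simps del: list.size sum.lessThan_Suc)
  then show ?L unfolding in_span_def by (intro exI[of _ "\<lambda>i. cs ! i"]) blast
qed

text \<open>These derivatives suffice to prolong fields with vanishing s-component, such as
  \<open>sym_field\<close> with \<open>c = 0\<close>.\<close>

lemma pd_gas_eq: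
  assumes "j \<in> jet_dom n"
  defines "P \<equiv> phi_pow n \<gamma> (ju j)" and "R \<equiv> jus j powr (- \<gamma>)" and "dS \<equiv> deriv S (js j)"
  defines "M \<equiv> dS - real n * \<gamma> * S (js j) * jus j / ju j - \<gamma> * S (js j) * juss j / jus j"
  shows "pd_t (gas_eq n \<gamma> S) j = 0"
    and "pd_u (gas_eq n \<gamma> S) j =
      real n * (1 - \<gamma>) * P / ju j * R * M + P * R * (real n * \<gamma> * S (js j) * jus j / (ju j)\<^sup>2)"
    and "pd_us (gas_eq n \<gamma> S) j = P * (- \<gamma> * R / jus j) * M
      + P * R * (- (real n * \<gamma> * S (js j) / ju j) + \<gamma> * S (js j) * juss j / (jus j)\<^sup>2)"
    and "pd_ut (gas_eq n \<gamma> S) j = 0"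
    and "pd_utt (gas_eq n \<gamma> S) j = 1"
    and "pd_uts (gas_eq n \<gamma> S) j = 0"
    and "pd_uss (gas_eq n \<gamma> S) j = P * R * (- (\<gamma> * S (js j) / jus j))"
proof -
  have j: "js j > 0" "n \<ge> 1 \<longrightarrow> ju j > 0" "jus j > 0"
    using assms by (auto simp: jet_dom_def base_dom_def base_def)
  have u: "((\<lambda>x. real n * \<gamma> * S (js j) * jus j / x) has_real_derivative
      - (real n * \<gamma> * S (js j) * jus j / (ju j)\<^sup>2)) (at (ju j))"
    using j(2) by (cases "n = 0") (auto intro!: derivative_eq_intros simp: power2_eq_square)
  have b: "((\<lambda>x. \<gamma> * S (js j) * juss j / x) has_real_derivative
      - (\<gamma> * S (js j) * juss j / (jus j)\<^sup>2)) (at (jus j))"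
    using j(3) by (auto intro!: derivative_eq_intros simp: power2_eq_square)
  have R: "((\<lambda>x. x powr (- \<gamma>)) has_real_derivative - \<gamma> * R / jus j) (at (jus j))"
    using has_real_derivative_powr[OF j(3), of "- \<gamma>"] j(3) by (simp add: powr_diff R_def)
  note dP = deriv_phi_pow[OF j(2), of \<gamma>]
  show "pd_t (gas_eq n \<gamma> S) j = 0" "pd_ut (gas_eq n \<gamma> S) j = 0" "pd_utt (gas_eq n \<gamma> S) j = 1" "pd_uts (gas_eq n \<gamma> S) j = 0"
    "pd_uss (gas_eq n \<gamma> S) j = P * R * (- (\<gamma> * S (js j) / jus j))"
    unfolding pd_t_def pd_ut_def pd_utt_def pd_uts_def pd_uss_def gas_eq_def using j(3)
    by (auto intro!: DERIV_imp_deriv derivative_eq_intros simp: P_def R_def)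
  show "pd_u (gas_eq n \<gamma> S) j =
      real n * (1 - \<gamma>) * P / ju j * R * M + P * R * (real n * \<gamma> * S (js j) * jus j / (ju j)\<^sup>2)"
    unfolding pd_u_def
  proof (rule DERIV_imp_deriv)
    have "((\<lambda>x. jutt j + phi_pow n \<gamma> x * R * (dS - real n * \<gamma> * S (js j) * jus j / x
          - \<gamma> * S (js j) * juss j / jus j)) has_real_derivative
        0 + ((real n * (1 - \<gamma>) * P / ju j * R + 0 * P) * M
          + (0 - - (real n * \<gamma> * S (js j) * jus j / (ju j)\<^sup>2) - 0) * (P * R))) (at (ju j))"
      unfolding P_def M_def by (intro DERIV_add DERIV_mult DERIV_diff DERIV_const dP u)
    then show "((\<lambda>x. gas_eq n \<gamma> S (j\<lparr>ju := x\<rparr>)) has_real_derivative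
        real n * (1 - \<gamma>) * P / ju j * R * M
        + P * R * (real n * \<gamma> * S (js j) * jus j / (ju j)\<^sup>2)) (at (ju j))"
      unfolding gas_eq_def by (simp add: R_def dS_def mult.commute mult.left_commute)
  qed
  show "pd_us (gas_eq n \<gamma> S) j = P * (- \<gamma> * R / jus j) * M
      + P * R * (- (real n * \<gamma> * S (js j) / ju j) + \<gamma> * S (js j) * juss j / (jus j)\<^sup>2)"
    unfolding pd_us_def
  proof (rule DERIV_imp_deriv)
    have "((\<lambda>x. jutt j + P * x powr (- \<gamma>) * (dS - real n * \<gamma> * S (js j) / ju j * x
          - \<gamma> * S (js j) * juss j / x)) has_real_derivative
        0 + (P * (- \<gamma> * R / jus j)
            * (dS - real n * \<gamma> * S (js j) / ju j * jus j - \<gamma> * S (js j) * juss j / jus j)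
          + (0 - real n * \<gamma> * S (js j) / ju j * 1 - - (\<gamma> * S (js j) * juss j / (jus j)\<^sup>2))
            * (P * jus j powr (- \<gamma>)))) (at (jus j))"
      by (intro DERIV_add DERIV_mult DERIV_diff DERIV_const DERIV_cmult DERIV_ident R b)
    then show "((\<lambda>x. gas_eq n \<gamma> S (j\<lparr>jus := x\<rparr>)) has_real_derivative
        P * (- \<gamma> * R / jus j) * M
        + P * R * (- (real n * \<gamma> * S (js j) / ju j) + \<gamma> * S (js j) * juss j / (jus j)\<^sup>2)) (at (jus j))"
      unfolding gas_eq_def by (simp add: R_def dS_def P_def M_def mult.commute mult.left_commute)
  qed
qed

text \<open>With \<kappa> = \<open>k1 / 2 + k2 * jt j\<close> the prolonged field multiplies
  \<open>jutt\<close> by -3 \<kappa> and the pressure term by \<kappa> (n (1 - \<gamma>) -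
  \<gamma>). On solutions the sum is the pressure term times -\<kappa> \<beta>, which is 0.\<close>

lemma point_symmetry_sym_field:
  assumes X: "\<And>p. p \<in> base_dom n \<Longrightarrow> X p = sym_field k0 k1 k2 0 h0 h1 p"
    and h: "n \<ge> 1 \<longrightarrow> h0 = 0 \<and> h1 = 0" and \<beta>: "\<beta> = 0"
  shows "point_symmetry n (gas_eq n \<gamma> S) X"
  unfolding point_symmetry_def
proof (intro conjI ballI impI)
  show "smooth_on (base_dom n) X"
    using smooth_on_cong[OF open_base_dom X[symmetric] smooth_on_sym_field] by blast
  fix j assume j: "j \<in> jet_dom n" and F: "gas_eq n \<gamma> S j = 0"
  have jp: "js j > 0" "n \<ge> 1 \<longrightarrow> ju j > 0" "jus j > 0"
    using j by (auto simp: jet_dom_def base_dom_def base_def)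
  let ?sym_field = "sym_field k0 k1 k2 0 h0 h1"
  let ?F = "gas_eq n \<gamma> S"
  have xi: "xi_t ?sym_field = (\<lambda>j. k0 + k1 * jt j + k2 * (jt j)\<^sup>2)" "xi_s ?sym_field = (\<lambda>j. 0)"
    "eta ?sym_field = (\<lambda>j. (k1 / 2 + k2 * jt j) * ju j + h0 + h1 * jt j)"
    by (auto simp: xi_t_def xi_s_def eta_def sym_field_def base_def)
  have d: "deriv (\<lambda>x. k0 + k1 * x + k2 * x\<^sup>2) t = k1 + 2 * k2 * t"
    "deriv (\<lambda>x. (k1 / 2 + k2 * x) * u + h0 + h1 * x) t = k2 * u + h1"
    "deriv (\<lambda>x. (k1 / 2 + k2 * t) * x + h0 + h1 * t) u = k1 / 2 + k2 * t"
    "deriv (\<lambda>x. k2 * u + h1 - (k1 / 2 + k2 * x) * v) t = - k2 * v"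
    "deriv (\<lambda>x. k2 * x + h1 - v) u = k2"
    "deriv (\<lambda>x. k2 * u + h1 - (k1 / 2 + k2 * t) * x) v = - (k1 / 2 + k2 * t)"
    "deriv (\<lambda>x. (k1 / 2 + k2 * t) * x) v = k1 / 2 + k2 * t" for t u v
    by (rule DERIV_imp_deriv; auto intro!: derivative_eq_intros)+
  have D: "D_t (xi_t ?sym_field) = (\<lambda>j. k1 + 2 * k2 * jt j)" "D_s (xi_t ?sym_field) = (\<lambda>j. 0)"
    "D_t (xi_s ?sym_field) = (\<lambda>j. 0)" "D_s (xi_s ?sym_field) = (\<lambda>j. 0)"
    "D_t (eta ?sym_field) = (\<lambda>j. k2 * ju j + h1 + jut j * (k1 / 2 + k2 * jt j))"
    "D_s (eta ?sym_field) = (\<lambda>j. jus j * (k1 / 2 + k2 * jt j))"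
    unfolding xi D_t_def D_s_def pd_t_def pd_s_def pd_u_def pd_ut_def pd_us_def by (simp_all add: d)
  have zt: "zeta_t ?sym_field = (\<lambda>j. k2 * ju j + h1 - (k1 / 2 + k2 * jt j) * jut j)"
    and zs: "zeta_s ?sym_field = (\<lambda>j. (k1 / 2 + k2 * jt j) * jus j)"
    unfolding zeta_t_def zeta_s_def D by (auto simp: field_simps)
  have ztt: "zeta_tt ?sym_field j = - 3 * (k1 / 2 + k2 * jt j) * jutt j"
    unfolding zeta_tt_def D zt D_t_def pd_t_def pd_u_def pd_ut_def pd_us_def
    by (simp add: d) (simp add: field_simps)
  have zss: "zeta_ss ?sym_field j = (k1 / 2 + k2 * jt j) * juss j"
    unfolding zeta_ss_def D zs D_s_def pd_s_def pd_u_def pd_ut_def pd_us_def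
    by (simp add: d)
  define \<kappa> where "\<kappa> = k1 / 2 + k2 * jt j"
  define P where "P = phi_pow n \<gamma> (ju j)"
  define R where "R = jus j powr (- \<gamma>)"
  define M where "M = deriv S (js j) - real n * \<gamma> * S (js j) * jus j / ju j
      - \<gamma> * S (js j) * juss j / jus j"
  note pd = pd_gas_eq[OF j, folded P_def R_def, folded M_def]
  have u: "eta ?sym_field j * pd_u ?F j =
      \<kappa> * (real n * (1 - \<gamma>) * P * R * M + P * R * (real n * \<gamma> * S (js j) * jus j / ju j))"
    unfolding pd xi using h jp(2)
    by (cases "n = 0") (auto simp: \<kappa>_def field_simps power2_eq_square)
  have us: "zeta_s ?sym_field j * pd_us ?F j = \<kappa> * (P * (- \<gamma> * R) * M
      + P * R * (- (real n * \<gamma> * S (js j) * jus j / ju j) + \<gamma> * S (js j) * juss j / jus j))"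
    unfolding pd zs \<kappa>_def[symmetric] using jp(3) by (simp add: field_simps power2_eq_square)
  have uss: "zeta_ss ?sym_field j * pd_uss ?F j = \<kappa> * (P * R * (- (\<gamma> * S (js j) * juss j / jus j)))"
    unfolding pd zss \<kappa>_def[symmetric] by simp
  have tt: "jutt j = - (P * R * M)"
    using F by (simp add: gas_eq_def P_def R_def M_def)
  have "prolong2 ?sym_field ?F j = \<kappa> * (P * R * M) * (real n * (1 - \<gamma>) - \<gamma> + 3)"
    unfolding prolong2_def prolong1_def u us uss
    unfolding pd ztt \<kappa>_def[symmetric] tt
    by (simp add: xi algebra_simps)
  also have "real n * (1 - \<gamma>) - \<gamma> + 3 = 0" using \<beta> by (simp add: \<beta>_def algebra_simps)
  finally show "prolong2 X ?F j = 0" using prolong2_cong[OF X j] by simp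
qed

end

section \<open>Conservation laws\<close>

context power_entropy_gas
begin

text \<open>Treats \<open>Z2\<close> and \<open>scaling_ts\<close> together as scalings with weights
  \<open>a\<close>, \<open>b\<close>, \<open>k\<close>. On solutions the divergence is a combination
  of \<open>jut\<close> squared and \<open>W * jus powr (1 - \<gamma>)\<close>; the two weight
  relations make its two coefficients vanish.\<close>

lemma scaling_conservation_law:
  fixes a b k :: real and Tt Ts :: "jet \<Rightarrow> real"
  assumes k: "2 * k = a - b" and ab: "a * \<beta> = b * \<alpha>"
    and Tt: "Tt = (\<lambda>j. - a * jt j * gas_E n \<gamma> S j - b * js j * jus j * jut j + k * ju j * jut j)"
    and Ts: "Ts = (\<lambda>j. - a * jt j * S (js j) * phi_pow n \<gamma> (ju j) * jut j * jus j powr (- \<gamma>)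
      + b * js j * gas_G n \<gamma> S j
      + k * S (js j) * (ju j * phi_pow n \<gamma> (ju j)) * jus j powr (- \<gamma>))"
  shows "gives_conservation_law n (gas_L n \<gamma> S) (gas_eq n \<gamma> S)
    (\<lambda>(t, s, u). (a * t, b * s, k * u)) Tt Ts"
  unfolding gives_conservation_law_def conservation_law_def
proof (intro conjI ballI impI)
  fix j assume j: "j \<in> jet_dom n"
  have jp: "js j > 0" "n \<ge> 1 \<longrightarrow> ju j > 0" "jus j > 0"
    using j by (auto simp: jet_dom_def base_dom_def base_def)
  have SP: "S s * phi_pow n \<gamma> u = (\<gamma> - 1) * W s u" for s u
    using gamma by (simp add: W_def)
  have E: "gas_E n \<gamma> S = (\<lambda>j. (jut j)\<^sup>2 / 2 + W (js j) (ju j) * jus j powr (1 - \<gamma>))"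
    and G: "gas_G n \<gamma> S = (\<lambda>j. (jut j)\<^sup>2 / 2 - \<gamma> * W (js j) (ju j) * jus j powr (1 - \<gamma>))"
    by (auto simp: gas_E_def gas_G_def W_def)
  have Tt': "Tt = (\<lambda>j. - a * jt j * ((jut j)\<^sup>2 / 2 + W (js j) (ju j) * jus j powr (1 - \<gamma>))
      - b * js j * jus j * jut j + k * ju j * jut j)"
    unfolding Tt E ..
  have Ts': "Ts = (\<lambda>j. - a * jt j * ((\<gamma> - 1) * W (js j) (ju j)) * jut j * jus j powr (- \<gamma>)
      + b * js j * ((jut j)\<^sup>2 / 2 - \<gamma> * W (js j) (ju j) * jus j powr (1 - \<gamma>))
      + k * ju j * ((\<gamma> - 1) * W (js j) (ju j)) * jus j powr (- \<gamma>))"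
    unfolding Ts G SP[symmetric] by (simp add: mult.assoc mult.left_commute)
  let ?t = "jt j" and ?s = "js j" and ?u = "ju j" and ?x = "jut j" and ?y = "jus j"
  define R where "R = jus j powr (- \<gamma>)"
  define K where "K = R / jus j"
  define w where "w = W (js j) (ju j)"
  have pw: "jus j powr (1 - \<gamma>) = jus j * R"
    using jp(3) by (simp add: R_def powr_diff powr_minus field_simps)
  let ?X = "\<lambda>(t, s, u). (a * t, b * s, k * u)"
  show "Tt j = xi_t ?X j * gas_L n \<gamma> S j + characteristic ?X j * pd_ut (gas_L n \<gamma> S) j"
    unfolding pd_gas_L(4)[OF j] Tt' gas_L_W
    by (simp add: characteristic_def xi_t_def xi_s_def eta_def base_def algebra_simps power2_eq_square)
  show "Ts j = xi_s ?X j * gas_L n \<gamma> S j + characteristic ?X j * pd_us (gas_L n \<gamma> S) j"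
    unfolding pd_gas_L(5)[OF j] Ts' gas_L_W pw R_def[symmetric]
    by (simp add: characteristic_def xi_t_def xi_s_def eta_def base_def algebra_simps power2_eq_square)
  assume F: "gas_eq n \<gamma> S j = 0"
  have dB: "((\<lambda>x. x powr (1 - \<gamma>)) has_real_derivative (1 - \<gamma>) * R) (at (jus j))"
    using has_real_derivative_powr[OF jp(3), of "1 - \<gamma>"] by (simp add: R_def)
  have Kp: "?y powr (- \<gamma> - 1) = K" using jp(3) by (simp add: powr_diff R_def K_def)
  have dR: "((\<lambda>x. x powr (- \<gamma>)) has_real_derivative - \<gamma> * K) (at (jus j))"
    using has_real_derivative_powr[OF jp(3), of "- \<gamma>"] jp(3) by (simp add: powr_diff R_def K_def)
  define qs where "qs = q / js j"
  define nu where "nu = real n * (1 - \<gamma>) / ju j"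
  note dW = W_DERIV_s[OF jp(1), of "ju j", folded qs_def w_def]
    W_DERIV_u[OF jp(2), of "js j", folded nu_def w_def]
  have Tt_pd: "pd_t Tt j = - a * (?x\<^sup>2 / 2 + w * (?y * R))"
    "pd_u Tt j = - a * ?t * (nu * w * (?y * R)) + k * ?x"
    "pd_ut Tt j = - a * ?t * ?x - b * ?s * ?y + k * ?u"
    "pd_us Tt j = - a * ?t * (w * ((1 - \<gamma>) * R)) - b * ?s * ?x"
    unfolding pd_t_def pd_u_def pd_ut_def pd_us_def Tt'
    by (auto intro!: DERIV_imp_deriv derivative_eq_intros dB dW
        simp: pw w_def[symmetric] R_def[symmetric] jp)
  have Ts_pd: "pd_s Ts j = - a * ?t * ((\<gamma> - 1) * (qs * w)) * ?x * R
      + (b * (?x\<^sup>2 / 2 - \<gamma> * w * (?y * R)) - b * ?s * (\<gamma> * (qs * w) * (?y * R)))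
      + k * ?u * ((\<gamma> - 1) * (qs * w)) * R"
    "pd_u Ts j = - a * ?t * ((\<gamma> - 1) * (nu * w)) * ?x * R - b * ?s * (\<gamma> * (nu * w) * (?y * R))
      + (k * ((\<gamma> - 1) * w) + k * ?u * ((\<gamma> - 1) * (nu * w))) * R"
    "pd_ut Ts j = - a * ?t * ((\<gamma> - 1) * w) * R + b * ?s * ?x"
    "pd_us Ts j = a * ?t * ((\<gamma> - 1) * w) * ?x * (\<gamma> * K) - b * ?s * (\<gamma> * w * ((1 - \<gamma>) * R))
      - k * ?u * ((\<gamma> - 1) * w) * (\<gamma> * K)"
    unfolding pd_s_def pd_u_def pd_ut_def pd_us_def Ts'
    by (auto intro!: DERIV_imp_deriv derivative_eq_intros dB dR dW
        simp: pw Kp w_def[symmetric] R_def[symmetric] jp)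
  have dS: "deriv S ?s = qs * S ?s"
    using DERIV_imp_deriv[OF S_DERIV[OF jp(1)]] by (simp add: qs_def)
  \<comment> \<open>The equation is solved for \<open>jutt\<close> in terms of the logarithmic
    derivatives \<open>qs\<close> and \<open>nu\<close> of \<open>W\<close>, so that it can be
    substituted into the divergence.\<close>
  have "(\<gamma> - 1) * real n * \<gamma> * w * R * ?y / ?u = - (\<gamma> * nu * w * R * ?y)"
    by (simp add: nu_def algebra_simps diff_divide_distrib)
  moreover have "gas_eq n \<gamma> S j = jutt j + R * (S ?s * phi_pow n \<gamma> ?u) * qs
      - real n * \<gamma> * (S ?s * phi_pow n \<gamma> ?u) * R * ?y / ?u - \<gamma> * (S ?s * phi_pow n \<gamma> ?u) * K * juss j"
    unfolding gas_eq_def dS R_def[symmetric] K_def by (simp add: algebra_simps)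
  ultimately have tt: "jutt j = - R * (\<gamma> - 1) * w * qs - \<gamma> * nu * w * R * ?y + \<gamma> * (\<gamma> - 1) * w * K * juss j"
    using F unfolding SP w_def[symmetric] by (simp add: algebra_simps)
  have s: "?s * qs = q" using jp(1) by (simp add: qs_def)
  have u: "?u * nu = real n * (1 - \<gamma>)" using jp(2) by (cases "n = 0") (auto simp: nu_def)
  have y: "R = ?y * K" using jp(3) by (simp add: K_def)
  \<comment> \<open>This is the last determining equation for the scaling field, equivalent to
    \<open>ab\<close> once \<open>a\<close> is eliminated through \<open>k\<close>.\<close>
  have c: "b * q + k * (real n * (1 - \<gamma>)) = (\<gamma> - 1) * (k - b) - (a + b)"
  proof -
    have a: "a = b + 2 * k" using k by simp
    show ?thesis using ab unfolding a \<alpha>_def \<beta>_def by (simp add: algebra_simps)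
  qed
  have "D_t Tt j + D_s Ts j
      = w * (?y * R) * ((\<gamma> - 1) * (k - b) - (a + b) - (b * (?s * qs) + k * (?u * nu)))
        + (2 * k - (a - b)) * (?x\<^sup>2 / 2)"
    unfolding D_t_def D_s_def Tt_pd Ts_pd tt y by (simp add: field_simps power2_eq_square)
  then show "D_t Tt j + D_s Ts j = 0"
    unfolding s u using c k by simp
qed

text \<open>A scaling has \<open>k2 = h1 = 0\<close> in \<open>sym_field\<close>, so its potentials
  are 0.\<close>

lemma variational_symmetry_scaling:
  assumes "2 * k = a - b" and "a * \<beta> = b * \<alpha>"
  shows "variational_symmetry n (gas_L n \<gamma> S) (\<lambda>(t, s, u). (a * t, b * s, k * u))"
proof -
  have k: "k = (a - b) / 2" using assms(1) by simp
  have sym_field: "(\<lambda>(t, s, u). (a * t, b * s, k * u)) = sym_field 0 a 0 b 0 0"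
    unfolding sym_field_def k by simp
  show ?thesis
    using noether_symmetry_with_sym_field[of 0 0 a b 0 0] assms(2)
    unfolding variational_symmetry_def sym_field by (simp add: case_prod_beta')
qed

text \<open>At (0, 1, 1) the s-component is \<open>b\<close>, whereas every generator in the list
  has s-component 0.\<close>

lemma not_in_span_arbitrary_scaling:
  assumes "b \<noteq> 0"
  shows "\<not> in_span n (arbitrary_entropy_symmetries n \<gamma>) (\<lambda>(t, s, u). (a * t, b * s, k * u))"
proof
  assume "in_span n (arbitrary_entropy_symmetries n \<gamma>) (\<lambda>(t, s, u). (a * t, b * s, k * u))"
  moreover have "(0, 1, 1) \<in> base_dom n" by (simp add: base_dom_def)
  ultimately show False
    unfolding in_span_arbitrary_entropy_iff using assms by (auto simp: sym_field_def dest!: bspec[where x = "(0, 1, 1)"])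
qed

lemma Z2_scaling: "Z2 n \<gamma> q = (\<lambda>(t, s, u). (\<alpha> * t, \<beta> * s, (\<gamma> + q + 1) * u))"
  by (simp add: Z2_def \<alpha>_def \<beta>_def)

lemma Z2_weight: "2 * (\<gamma> + q + 1) = \<alpha> - \<beta>"
  by (simp add: \<alpha>_def \<beta>_def algebra_simps)

lemma scaling_ts_scaling: "scaling_ts = (\<lambda>(t, s, u). (1 * t, 1 * s, 0 * u))"
  by (simp add: scaling_ts_def)

text \<open>Adding \<open>d\<close> times the scaling shifts \<open>k1\<close> by
  \<open>d * a\<close> and \<open>c\<close> by \<open>d * b\<close>; the weight relation makes the
  \<phi>-component follow suit.\<close>

lemma in_span_with_scaling_iff:
  assumes "2 * k = a - b"
  shows "in_span n (arbitrary_entropy_symmetries n \<gamma> @ [\<lambda>(t, s, u). (a * t, b * s, k * u)]) X \<longleftrightarrow>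
    (\<exists>d k0 k1 k2 h0 h1. (\<forall>p\<in>base_dom n. X p = sym_field k0 (k1 + d * a) k2 (d * b) h0 h1 p)
      \<and> (n \<ge> 1 \<longrightarrow> h0 = 0 \<and> h1 = 0) \<and> k1 * \<beta> = 0 \<and> k2 * \<beta> = 0)"
proof -
  have k: "k = (a - b) / 2" using assms by simp
  have "X p - d *\<^sub>R (case p of (t, s, u) \<Rightarrow> (a * t, b * s, k * u)) = sym_field k0 k1 k2 0 h0 h1 p \<longleftrightarrow>
      X p = sym_field k0 (k1 + d * a) k2 (d * b) h0 h1 p" for d k0 k1 k2 h0 h1 p
    unfolding k sym_field_def by (cases p; cases "X p") (auto simp: field_simps)
  then show ?thesis
    unfolding in_span_append_single in_span_arbitrary_entropy_iff by simp
qed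

end

section \<open>The three regimes of the linear relation
  \<open>k1 * \<beta> = c * \<alpha>\<close>\<close>

theorem mainTheorem5:
  fixes n :: nat and \<gamma> A\<^sub>0 q :: real and S :: "real \<Rightarrow> real"
  assumes "n \<in> {0, 1, 2}" and "\<gamma> > 1" and "A\<^sub>0 > 0" and "q \<noteq> 0"
    and "S = (\<lambda>s. A\<^sub>0 * s powr q)"
  shows
    "(\<gamma> \<noteq> gamma_star n \<longrightarrow>
        (\<forall>X. noether_symmetry n (gas_L n \<gamma> S) X \<longleftrightarrow>
             in_span n (arbitrary_entropy_symmetries n \<gamma> @ [Z2 n \<gamma> q]) X)
        \<and> \<not> in_span n (arbitrary_entropy_symmetries n \<gamma>) (Z2 n \<gamma> q)
        \<and> variational_symmetry n (gas_L n \<gamma> S) (Z2 n \<gamma> q)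
        \<and> gives_conservation_law n (gas_L n \<gamma> S) (gas_eq n \<gamma> S) (Z2 n \<gamma> q)
            (T2_t n \<gamma> q S) (T2_s n \<gamma> q S))
     \<and> (\<gamma> = gamma_star n \<and> q \<noteq> q_star n \<longrightarrow>
        (\<forall>X. point_symmetry n (gas_eq n \<gamma> S) X \<and> noether_symmetry n (gas_L n \<gamma> S) X \<longleftrightarrow>
             in_span n (arbitrary_entropy_symmetries n \<gamma>) X))
     \<and> (\<gamma> = gamma_star n \<and> q = q_star n \<longrightarrow>
        (\<forall>X. noether_symmetry n (gas_L n \<gamma> S) X \<longleftrightarrow>
             in_span n (arbitrary_entropy_symmetries n \<gamma> @ [scaling_ts]) X)
        \<and> \<not> in_span n (arbitrary_entropy_symmetries n \<gamma>) scaling_ts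
        \<and> variational_symmetry n (gas_L n \<gamma> S) scaling_ts
        \<and> gives_conservation_law n (gas_L n \<gamma> S) (gas_eq n \<gamma> S) scaling_ts
            (T_t n \<gamma> S) (T_s n \<gamma> S))"
proof -
  interpret power_entropy_gas n \<gamma> A\<^sub>0 q S by unfold_locales (use assms in auto)
  note noether = noether_symmetry_iff[OF assms(4)]
  show ?thesis
  proof (intro conjI impI allI)
    assume "\<gamma> \<noteq> gamma_star n"
    then have \<beta>: "\<beta> \<noteq> 0" by (simp add: beta_0_iff)
    show "noether_symmetry n (gas_L n \<gamma> S) X \<longleftrightarrow>
        in_span n (arbitrary_entropy_symmetries n \<gamma> @ [Z2 n \<gamma> q]) X" for X
    proof
      assume "noether_symmetry n (gas_L n \<gamma> S) X"
      then obtain k0 k1 k2 c h0 h1 where X: "\<forall>p\<in>base_dom n. X p = sym_field k0 k1 k2 c h0 h1 p"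
        and *: "n \<ge> 1 \<longrightarrow> h0 = 0 \<and> h1 = 0" "k1 * \<beta> = c * \<alpha>" "k2 * \<beta> = 0"
        unfolding noether by blast
      \<comment> \<open>For \<beta> \<noteq> 0 the pair (\<open>k1\<close>, \<open>c\<close>) is a
        multiple of (\<alpha>, \<beta>), so the coefficient of \<open>Z2\<close> is
        \<open>c / \<beta>\<close> and no separate \<open>k1\<close> remains.\<close>
      have "k1 = 0 + c / \<beta> * \<alpha>" "c = c / \<beta> * \<beta>" using \<beta> *(2) by (simp_all add: field_simps)
      with X have "\<forall>p\<in>base_dom n. X p = sym_field k0 (0 + c / \<beta> * \<alpha>) k2 (c / \<beta> * \<beta>) h0 h1 p" by metis
      with *(1,3) show "in_span n (arbitrary_entropy_symmetries n \<gamma> @ [Z2 n \<gamma> q]) X"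
        unfolding Z2_scaling in_span_with_scaling_iff[OF Z2_weight] using mult_zero_left by blast
    next
      assume "in_span n (arbitrary_entropy_symmetries n \<gamma> @ [Z2 n \<gamma> q]) X"
      then obtain d k0 k1 k2 h0 h1 where
        X: "\<forall>p\<in>base_dom n. X p = sym_field k0 (k1 + d * \<alpha>) k2 (d * \<beta>) h0 h1 p"
        and *: "n \<ge> 1 \<longrightarrow> h0 = 0 \<and> h1 = 0" "k1 * \<beta> = 0" "k2 * \<beta> = 0"
        unfolding Z2_scaling in_span_with_scaling_iff[OF Z2_weight] by blast
      have "(k1 + d * \<alpha>) * \<beta> = d * \<beta> * \<alpha>" using *(2) by (simp add: algebra_simps)
      with X * show "noether_symmetry n (gas_L n \<gamma> S) X" unfolding noether by blast
    qed
    show "\<not> in_span n (arbitrary_entropy_symmetries n \<gamma>) (Z2 n \<gamma> q)"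
      unfolding Z2_scaling by (rule not_in_span_arbitrary_scaling[OF \<beta>])
    show "variational_symmetry n (gas_L n \<gamma> S) (Z2 n \<gamma> q)"
      unfolding Z2_scaling by (rule variational_symmetry_scaling[OF Z2_weight]) simp
    show "gives_conservation_law n (gas_L n \<gamma> S) (gas_eq n \<gamma> S) (Z2 n \<gamma> q)
        (T2_t n \<gamma> q S) (T2_s n \<gamma> q S)"
      unfolding Z2_scaling
      by (rule scaling_conservation_law[OF Z2_weight])
        (simp_all add: T2_t_def[abs_def] T2_s_def[abs_def] \<alpha>_def \<beta>_def)
  next
    assume g: "\<gamma> = gamma_star n \<and> q \<noteq> q_star n"
    then have \<beta>: "\<beta> = 0" and \<alpha>: "\<alpha> \<noteq> 0" using beta_0_iff alpha_0_iff by blast+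
    fix X
    show "point_symmetry n (gas_eq n \<gamma> S) X \<and> noether_symmetry n (gas_L n \<gamma> S) X \<longleftrightarrow>
        in_span n (arbitrary_entropy_symmetries n \<gamma>) X"
    proof
      assume "point_symmetry n (gas_eq n \<gamma> S) X \<and> noether_symmetry n (gas_L n \<gamma> S) X"
      then obtain k0 k1 k2 c h0 h1 where X: "\<forall>p\<in>base_dom n. X p = sym_field k0 k1 k2 c h0 h1 p"
        and *: "n \<ge> 1 \<longrightarrow> h0 = 0 \<and> h1 = 0" "k1 * \<beta> = c * \<alpha>"
        unfolding noether by blast
      \<comment> \<open>With \<beta> = 0 the relation reads \<open>0 = c * \<alpha>\<close>, and
        \<alpha> \<noteq> 0 excludes any scaling of \<open>s\<close>.\<close>
      have "c = 0" using *(2) \<alpha> \<beta> by simp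
      with X *(1) show "in_span n (arbitrary_entropy_symmetries n \<gamma>) X"
        unfolding in_span_arbitrary_entropy_iff \<beta> mult_zero_right by blast
    next
      assume "in_span n (arbitrary_entropy_symmetries n \<gamma>) X"
      then obtain k0 k1 k2 h0 h1 where X: "\<forall>p\<in>base_dom n. X p = sym_field k0 k1 k2 0 h0 h1 p"
        and h: "n \<ge> 1 \<longrightarrow> h0 = 0 \<and> h1 = 0"
        unfolding in_span_arbitrary_entropy_iff by blast
      then have "noether_symmetry n (gas_L n \<gamma> S) X"
        unfolding noether \<beta> mult_zero_right mult_zero_left by (metis mult_zero_left)
      moreover have "point_symmetry n (gas_eq n \<gamma> S) X"
        using point_symmetry_sym_field[OF _ h \<beta>] X by blast
      ultimately show "point_symmetry n (gas_eq n \<gamma> S) X \<and> noether_symmetry n (gas_L n \<gamma> S) X"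
        by blast
    qed
  next
    assume g: "\<gamma> = gamma_star n \<and> q = q_star n"
    then have \<beta>: "\<beta> = 0" and \<alpha>: "\<alpha> = 0" using beta_0_iff alpha_0_iff by blast+
    have weight: "2 * 0 = 1 - (1 :: real)" by simp
    show "noether_symmetry n (gas_L n \<gamma> S) X \<longleftrightarrow>
        in_span n (arbitrary_entropy_symmetries n \<gamma> @ [scaling_ts]) X" for X
    proof
      assume "noether_symmetry n (gas_L n \<gamma> S) X"
      then obtain k0 k1 k2 c h0 h1 where X: "\<forall>p\<in>base_dom n. X p = sym_field k0 k1 k2 c h0 h1 p"
        and h: "n \<ge> 1 \<longrightarrow> h0 = 0 \<and> h1 = 0"
        unfolding noether by blast
      \<comment> \<open>Here \<alpha> = \<beta> = 0 leaves \<open>c\<close> free; splitting off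
        \<open>c\<close> times \<open>scaling_ts\<close> leaves \<open>k1 - c\<close> for the
        generator listed under \<gamma> = \<open>gamma_star n\<close>.\<close>
      have "\<forall>p\<in>base_dom n. X p = sym_field k0 ((k1 - c) + c * 1) k2 (c * 1) h0 h1 p" using X by simp
      with h show "in_span n (arbitrary_entropy_symmetries n \<gamma> @ [scaling_ts]) X"
        unfolding scaling_ts_scaling in_span_with_scaling_iff[OF weight] \<beta> mult_zero_right by blast
    next
      assume "in_span n (arbitrary_entropy_symmetries n \<gamma> @ [scaling_ts]) X"
      then obtain d k0 k1 k2 h0 h1 where
        X: "\<forall>p\<in>base_dom n. X p = sym_field k0 (k1 + d * 1) k2 (d * 1) h0 h1 p"
        and h: "n \<ge> 1 \<longrightarrow> h0 = 0 \<and> h1 = 0"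
        unfolding scaling_ts_scaling in_span_with_scaling_iff[OF weight] by blast
      then show "noether_symmetry n (gas_L n \<gamma> S) X"
        unfolding noether \<alpha> \<beta> mult_zero_right by blast
    qed
    show "\<not> in_span n (arbitrary_entropy_symmetries n \<gamma>) scaling_ts"
      unfolding scaling_ts_scaling by (rule not_in_span_arbitrary_scaling) simp
    show "variational_symmetry n (gas_L n \<gamma> S) scaling_ts"
      unfolding scaling_ts_scaling by (rule variational_symmetry_scaling) (simp_all add: \<alpha> \<beta>)
    show "gives_conservation_law n (gas_L n \<gamma> S) (gas_eq n \<gamma> S) scaling_ts (T_t n \<gamma> S) (T_s n \<gamma> S)"
      unfolding scaling_ts_scaling
      by (rule scaling_conservation_law)
        (simp_all add: T_t_def[abs_def] T_s_def[abs_def] \<alpha> \<beta>)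
  qed
qed

end
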